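(* Let $k \ge 2$ be an integer and let $G$ be a complete directed graph of order at least $k+2\Omega(k)$ in which every vertex and every edge is assigned a weight in $\mathbb{Z}_k$. Then $G$ contains a directed cycle whose weight is $0$ in $\mathbb{Z}_k$.
   Context: All graphs are simple. A complete directed graph has, for every ordered pair $(x,y)$ of distinct vertices, exactly one directed edge $xy$; in particular a pair of opposite edges $x,y$ forms a directed cycle of length 2. The weight of a subgraph is the sum (in $\mathbb{Z}_k$) of the weights of its vertices and edges. $\Omega(k)$ denotes the number of prime factors of $k$ counted with multiplicity. *)

theory Defs
  imports
    "Graph_Theory.Graph_Theory"
    "HOL-Computational_Algebra.Primes"
    "HOL-Number_Theory.Cong"
begin

(* Weights in Z_k are represented by integers, to be read modulo k. *)
definition subgraph_weight ::
  "('a \<Rightarrow> int) \<Rightarrow> ('b \<Rightarrow> int) \<Rightarrow> ('a, 'b) pre_digraph \<Rightarrow> int" where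
  "subgraph_weight wv we H = (\<Sum>v\<in>verts H. wv v) + (\<Sum>e\<in>arcs H. we e)"

(* A cycle in Graph_Theory is a list of arcs; its subgraph has no other vertices than the
   ends of these arcs, so the vertex at which the closed walk starts counts only once. *)
definition walk_subgraph ::
  "('a, 'b) pre_digraph \<Rightarrow> 'b list \<Rightarrow> ('a, 'b) pre_digraph" where
  "walk_subgraph G p =
     \<lparr>verts = tail G ` set p \<union> head G ` set p, arcs = set p, tail = tail G, head = head G\<rparr>"

definition big_omega :: "nat \<Rightarrow> nat" where
  "big_omega k = size (prime_factorization k)"

end

theory Submission
  imports Defs
begin

text \<open>
  Vertex weights are absorbed into the arcs, and \<open>k\<close> is reduced by induction. Among all vertex
  sets \<open>S\<close> with endpoints \<open>s\<close>, \<open>t\<close> such that the paths from \<open>s\<close> to \<open>t\<close> inside \<open>S\<close> realise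
  a set \<open>A\<close> of at least \<open>|S| - 1\<close> residues, take one of maximal size, and let \<open>U\<close> be the set of
  the remaining vertices. After subtracting a potential, every arc from \<open>t\<close> into \<open>U\<close> has weight 0,
  and maximality forces \<open>|A \<union> (A + h)| \<le> |A| + 1\<close> for every arc weight \<open>h\<close> inside \<open>U\<close>. The
  elements \<open>h\<close> with this property form a subgroup or are \<open>0\<close>, \<open>h\<close>, \<open>-h\<close> only.
  If the weights inside \<open>U\<close> lie in a proper subgroup whose order is at most one more than the
  number of residues missing from \<open>A\<close>, then \<open>U\<close> is large enough for the induction hypothesis; the
  summand \<open>2 \<Omega>(k)\<close> pays for the two vertices lost in this step. Otherwise the weights are
  \<open>0\<close>, \<open>h\<close> and \<open>-h\<close>, and, unless there is a zero-sum cycle, \<open>U\<close> has a Hamiltonian path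
  all of whose arcs have weight \<open>h\<close> (or all \<open>-h\<close>); its final segments complete \<open>A\<close> to all
  residues.
\<close>

section \<open>Sets of residues\<close>

text \<open>A subset of \<open>Z\<^sub>k\<close> is represented by its preimage in the integers, a periodic set.\<close>

definition periodic :: "nat \<Rightarrow> int set \<Rightarrow> bool" where
  "periodic k A \<longleftrightarrow> (\<forall>x y. [x = y] (mod int k) \<longrightarrow> x \<in> A \<longrightarrow> y \<in> A)"

definition dens :: "nat \<Rightarrow> int set \<Rightarrow> nat" where
  "dens k A = card (A \<inter> {0..<int k})"

definition translate :: "int \<Rightarrow> int set \<Rightarrow> int set" where
  "translate h A = {x. x - h \<in> A}"

text \<open>At most one residue leaves \<open>A\<close> when \<open>h\<close> is added, that is, |(A
  + h) - A| <= 1. The elementwise form suits \<open>tight_add\<close>; the count is recovered in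
  \<open>not_tight_gain\<close> and \<open>tight_dens\<close>.\<close>

definition tight :: "nat \<Rightarrow> int set \<Rightarrow> int \<Rightarrow> bool" where
  "tight k A h \<longleftrightarrow>
     (\<forall>x\<in>A. \<forall>y\<in>A. x + h \<notin> A \<longrightarrow> y + h \<notin> A \<longrightarrow> [x = y] (mod int k))"

lemma periodicD: "periodic k A \<Longrightarrow> [x = y] (mod int k) \<Longrightarrow> x \<in> A \<longleftrightarrow> y \<in> A"
  unfolding periodic_def by (meson cong_sym)

lemma periodic_mod: "periodic k A \<Longrightarrow> x mod int k \<in> A \<longleftrightarrow> x \<in> A"
  by (rule periodicD) auto

lemma periodic_empty: "periodic k {}"
  by (simp add: periodic_def)

lemma periodic_translate:
  assumes "periodic k A"
  shows "periodic k (translate h A)"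
  unfolding periodic_def translate_def
  using periodicD[OF assms] by (auto simp: cong_diff) (meson cong_diff cong_refl)

lemma periodic_Un: "periodic k A \<Longrightarrow> periodic k B \<Longrightarrow> periodic k (A \<union> B)"
  unfolding periodic_def by blast

lemma periodic_Compl: "periodic k A \<Longrightarrow> periodic k (- A)"
  unfolding periodic_def by (meson ComplD ComplI cong_sym)

text \<open>Both sets are periodic, so reducing \<open>F\<close> modulo \<open>k\<close> keeps it
  inside \<open>B\<close> and outside \<open>A\<close>, and no two of its elements collapse.\<close>

lemma dens_gain:
  assumes k: "k > 0" and A: "periodic k A" and B: "periodic k B" and AB: "A \<subseteq> B"
    and F: "finite F" "F \<subseteq> B - A" "inj_on (\<lambda>x. x mod int k) F"
  shows "dens k A + card F \<le> dens k B"
proof -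
  let ?G = "(\<lambda>x. x mod int k) ` F"
  have sub: "?G \<subseteq> (B - A) \<inter> {0..<int k}"
    using F(2) k periodic_mod[OF A] periodic_mod[OF B] by auto
  have "dens k A + card F = card (A \<inter> {0..<int k}) + card ?G"
    using F(3) by (simp add: dens_def card_image)
  also have "\<dots> = card ((A \<inter> {0..<int k}) \<union> ?G)"
    using sub F(1) by (subst card_Un_disjoint) auto
  also have "\<dots> \<le> dens k B"
    unfolding dens_def using sub AB by (intro card_mono) auto
  finally show ?thesis .
qed

lemma card_le_dens:
  assumes "k > 0" "periodic k B" "finite F" "F \<subseteq> B" "inj_on (\<lambda>x. x mod int k) F"
  shows "card F \<le> dens k B"
  using dens_gain[OF assms(1) periodic_empty[of k] assms(2), of F] assms by (simp add: dens_def)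

lemma dens_mono: "A \<subseteq> B \<Longrightarrow> dens k A \<le> dens k B"
  unfolding dens_def by (intro card_mono) auto

lemma dens_Compl: "dens k A + dens k (- A) = k"
proof -
  have "card (A \<inter> {0..<int k}) + card (- A \<inter> {0..<int k})
      = card ((A \<inter> {0..<int k}) \<union> (- A \<inter> {0..<int k}))"
    by (subst card_Un_disjoint) auto
  also have "(A \<inter> {0..<int k}) \<union> (- A \<inter> {0..<int k}) = {0..<int k}" by auto
  finally show ?thesis by (simp add: dens_def)
qed

lemma dens_eq_full:
  assumes k: "k > 0" and A: "periodic k A" and d: "k \<le> dens k A"
  shows "x \<in> A"
proof -
  have "dens k (- A) = 0" using dens_Compl[of k A] d by simp
  then have "- A \<inter> {0..<int k} = {}" by (simp add: dens_def)
  then have "x mod int k \<in> A" using k by auto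
  then show ?thesis by (simp add: periodic_mod[OF A])
qed

lemma dens_translate_le:
  assumes k: "k > 0" and A: "periodic k A"
  shows "dens k A \<le> dens k (translate h A)"
proof -
  let ?F = "(\<lambda>x. x + h) ` (A \<inter> {0..<int k})"
  have "dens k A = card ?F"
    unfolding dens_def by (rule card_image[symmetric]) (auto simp: inj_on_def)
  also have "\<dots> \<le> dens k (translate h A)"
  proof (rule card_le_dens[OF k periodic_translate[OF A]])
    show "inj_on (\<lambda>x. x mod int k) ?F"
    proof (rule inj_onI)
      fix u v
      assume "u \<in> ?F" "v \<in> ?F" and e: "u mod int k = v mod int k"
      then obtain x y where xy: "x \<in> {0..<int k}" "y \<in> {0..<int k}" "u = x + h" "v = y + h"
        by auto
      then have "[x = y] (mod int k)" using e by (simp add: cong_def[symmetric] cong_add_rcancel)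
      then show "u = v" using xy by (simp add: cong_def)
    qed
  qed (auto simp: translate_def)
  finally show ?thesis .
qed

lemma dens_translate:
  assumes k: "k > 0" and A: "periodic k A"
  shows "dens k (translate h A) = dens k A"
proof -
  have "translate (- h) (translate h A) = A" by (simp add: translate_def)
  then show ?thesis
    using dens_translate_le[OF k A, of h]
      dens_translate_le[OF k periodic_translate[OF A], of h "- h"] by simp
qed

section \<open>Shifts that move at most one residue out of a set\<close>

lemma inj_mod_pair: "\<not> [x = y] (mod int k) \<Longrightarrow> inj_on (\<lambda>z. z mod int k) {x, y}"
  by (auto simp: inj_on_def cong_def)

lemma not_tight_gain:
  assumes k: "k > 0" and A: "periodic k A" and nt: "\<not> tight k A h"
  shows "dens k A + 2 \<le> dens k (A \<union> translate h A)"
proof -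
  obtain x y where xy: "x \<in> A" "y \<in> A" "x + h \<notin> A" "y + h \<notin> A" "\<not> [x = y] (mod int k)"
    using nt by (auto simp: tight_def)
  then have n: "\<not> [x + h = y + h] (mod int k)" by (simp add: cong_add_rcancel)
  then have "x + h \<noteq> y + h" by auto
  then show ?thesis
    using dens_gain[OF k A periodic_Un[OF A periodic_translate[OF A, of h]], of "{x + h, y + h}"]
      xy inj_mod_pair[OF n] by (auto simp: translate_def)
qed

lemma tight_dens:
  assumes k: "k > 0" and A: "periodic k A" and t: "tight k A h"
  shows "dens k (A \<union> translate h A) \<le> dens k A + 1"
proof -
  let ?N = "(translate h A - A) \<inter> {0..<int k}"
  have "x = y" if "x \<in> ?N" "y \<in> ?N" for x y
  proof -
    have "[x - h = y - h] (mod int k)"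
      using t that unfolding tight_def translate_def by auto
    then have "[x = y] (mod int k)" by (simp add: cong_iff_dvd_diff)
    then show ?thesis using that by (auto simp: cong_def)
  qed
  then have "card ?N \<le> 1" using card_le_Suc0_iff_eq[of ?N] by auto
  moreover have "(A \<union> translate h A) \<inter> {0..<int k} = (A \<inter> {0..<int k}) \<union> ?N" by auto
  ultimately show ?thesis
    unfolding dens_def using card_Un_le[of "A \<inter> {0..<int k}" ?N] by simp
qed

text \<open>Tightness is a condition on the number of residues in \<open>A \<union> (A + h)\<close>, and
  \<open>A \<union> (A - h)\<close> is a translate of this set.\<close>

lemma tight_uminus:
  assumes k: "k > 0" and A: "periodic k A" and t: "tight k A h"
  shows "tight k A (- h)"
proof (rule ccontr)
  assume "\<not> tight k A (- h)"
  from not_tight_gain[OF k A this]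
  have "dens k A + 2 \<le> dens k (A \<union> translate (- h) A)" .
  also have "\<dots> = dens k (translate h (A \<union> translate (- h) A))"
    by (rule dens_translate[symmetric]) (intro k periodic_Un A periodic_translate)+
  also have "translate h (A \<union> translate (- h) A) = A \<union> translate h A"
    by (auto simp: translate_def)
  finally show False using tight_dens[OF k A t] by simp
qed

lemma tight_0: "tight k A 0"
  by (auto simp: tight_def)

lemma tight_cong:
  assumes A: "periodic k A" and gh: "[g = h] (mod int k)" and t: "tight k A g"
  shows "tight k A h"
proof -
  have "x + g \<in> A \<longleftrightarrow> x + h \<in> A" for x
    using periodicD[OF A, of "x + g" "x + h"] gh by (simp add: cong_add_lcancel)
  then show ?thesis using t by (simp add: tight_def)
qed

text \<open>A residue that leaves \<open>A\<close> under \<open>g + h\<close> does so at once under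
  \<open>g\<close>, or else afterwards under \<open>h\<close>. Two residues leaving in the same way
  contradict tightness of \<open>g\<close> or of \<open>h\<close>, so one leaves in each way. Adding
  \<open>h\<close> before \<open>g\<close> instead then makes two of \<open>g\<close>,
  \<open>h\<close>, \<open>0\<close> congruent.\<close>

lemma tight_add:
  assumes A: "periodic k A" and g: "tight k A g" and h: "tight k A h"
    and gh: "\<not> [g = h] (mod int k)" and g0: "\<not> [g = 0] (mod int k)" and h0: "\<not> [h = 0] (mod int k)"
  shows "tight k A (g + h)"
  unfolding tight_def
proof (intro ballI impI, rule ccontr)
  fix x y
  assume xy: "x \<in> A" "y \<in> A" "x + (g + h) \<notin> A" "y + (g + h) \<notin> A" "\<not> [x = y] (mod int k)"
  have *: False if "x \<in> A" "y \<in> A" "x + (g + h) \<notin> A" "y + (g + h) \<notin> A"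
      "x + g \<notin> A" "y + g \<in> A" for x y
  proof -
    \<comment> \<open>\<open>y + g\<close> is the only residue of \<open>A\<close> leaving under
      \<open>h\<close>, and \<open>x\<close> the only one leaving under \<open>g\<close>.\<close>
    have 1: "[y + g = z] (mod int k)" if "z \<in> A" "z + h \<notin> A" for z
      using h \<open>y + g \<in> A\<close> \<open>y + (g + h) \<notin> A\<close> that unfolding tight_def by (simp add: add.assoc)
    have 2: "[z = x] (mod int k)" if "z \<in> A" "z + g \<notin> A" for z
      using g \<open>x \<in> A\<close> \<open>x + g \<notin> A\<close> that unfolding tight_def by blast
    show False
    proof (cases "y + h \<in> A")
      case True
      then have yh: "[y + h = x] (mod int k)"
        using 2[of "y + h"] \<open>y + (g + h) \<notin> A\<close> by (simp add: algebra_simps)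
      show False
      proof (cases "x + h \<in> A")
        case True
        then have "[x + h = x] (mod int k)"
          using 2[of "x + h"] \<open>x + (g + h) \<notin> A\<close> by (simp add: algebra_simps)
        then have "[x + h = x + 0] (mod int k)" by simp
        with h0 show False unfolding cong_add_lcancel by simp
      next
        case False
        then have "[y + g = y + h] (mod int k)"
          using 1[of x] yh \<open>x \<in> A\<close> by (meson cong_sym cong_trans)
        then show False using gh unfolding cong_add_lcancel by simp
      qed
    next
      case False
      then have "[y + g = y + 0] (mod int k)" using 1[of y] \<open>y \<in> A\<close> by simp
      with g0 show False unfolding cong_add_lcancel by simp
    qed
  qed
  show False
  proof (cases "x + g \<in> A"; cases "y + g \<in> A")
    assume "x + g \<in> A" "y + g \<in> A"
    then have "[x + g = y + g] (mod int k)"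
      using h xy unfolding tight_def by (simp add: add.assoc)
    then show False using xy by (simp add: cong_add_rcancel)
  next
    assume "x + g \<notin> A" "y + g \<notin> A"
    then show False using g xy unfolding tight_def by blast
  qed (use * xy in blast)+
qed

text \<open>Only doubling is in question. Given \<open>h\<close> and some \<open>g\<close> in
  \<open>D\<close> other than \<open>0\<close>, \<open>h\<close>, \<open>-h\<close>, the sum of
  \<open>h + g\<close> and \<open>h - g\<close> is \<open>h + h\<close> if these two are distinct.
  Otherwise \<open>g = -g\<close>, and \<open>h + h\<close> is the sum of \<open>h + (h + g)\<close>
  and \<open>-g\<close>, unless these coincide, in which case \<open>h + h\<close> is
  \<open>0\<close>.\<close>

lemma closed_or_pm:
  fixes D :: "int set"
  assumes D0: "0 \<in> D" and Dc: "periodic k D" and Dm: "\<And>h. h \<in> D \<Longrightarrow> - h \<in> D"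
    and Da: "\<And>g h. g \<in> D \<Longrightarrow> h \<in> D \<Longrightarrow> \<not> [g = h] (mod int k) \<Longrightarrow> \<not> [g = 0] (mod int k) \<Longrightarrow>
      \<not> [h = 0] (mod int k) \<Longrightarrow> g + h \<in> D"
  shows "(\<forall>g\<in>D. \<forall>h\<in>D. g + h \<in> D) \<or>
    (\<exists>h\<in>D. \<not> [h = 0] (mod int k) \<and>
      (\<forall>g\<in>D. [g = 0] (mod int k) \<or> [g = h] (mod int k) \<or> [g = - h] (mod int k)))"
proof (rule disjCI)
  assume npm: "\<not> (\<exists>h\<in>D. \<not> [h = 0] (mod int k) \<and>
      (\<forall>g\<in>D. [g = 0] (mod int k) \<or> [g = h] (mod int k) \<or> [g = - h] (mod int k)))"
  have add: "g + h \<in> D" if "g \<in> D" "h \<in> D" "\<not> [g = h] (mod int k)" for g h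
  proof (cases "[g = 0] (mod int k) \<or> [h = 0] (mod int k)")
    case True
    then have "[g + h = h] (mod int k) \<or> [g + h = g] (mod int k)"
      using cong_add[of g 0 "int k" h h] cong_add[of g g "int k" h 0] by auto
    then show ?thesis using that periodicD[OF Dc] by blast
  next
    case False
    then show ?thesis using Da that by blast
  qed
  have double: "h + h \<in> D" if h: "h \<in> D" for h
  proof (cases "[h = 0] (mod int k)")
    case True
    then have "[h + h = 0] (mod int k)" using cong_add[of h 0 "int k" h 0] by simp
    then show ?thesis using periodicD[OF Dc] D0 by blast
  next
    case h0: False
    with npm h obtain g where g: "g \<in> D" "\<not> [g = 0] (mod int k)" "\<not> [g = h] (mod int k)"
      "\<not> [g = - h] (mod int k)" by blast
    have hg: "h + g \<in> D" using add[OF h g(1)] g(3) by (meson cong_sym)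
    have "\<not> [h = - g] (mod int k)"
      using g(4) by (metis add.inverse_inverse cong_minus_minus_iff cong_sym_eq)
    then have hmg: "h + - g \<in> D" by (rule add[OF h Dm[OF g(1)]])
    show ?thesis
    proof (cases "[h + g = h + - g] (mod int k)")
      case False
      from add[OF hg hmg False] show ?thesis by simp
    next
      case True
      then have gm: "[g = - g] (mod int k)" unfolding cong_add_lcancel .
      have "\<not> [h = h + g] (mod int k)"
        using g(2) cong_add_lcancel[of h 0 g "int k"] by (auto simp: cong_sym_eq)
      from add[OF h hg this] have hhg: "h + (h + g) \<in> D" .
      show ?thesis
      proof (cases "[h + (h + g) = - g] (mod int k)")
        case True
        then have "[h + (h + g) = g] (mod int k)" using gm by (meson cong_sym cong_trans)
        then have "[(h + h) + g = 0 + g] (mod int k)" by (simp add: add.assoc)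
        then have "[h + h = 0] (mod int k)" unfolding cong_add_rcancel .
        then show ?thesis using periodicD[OF Dc] D0 by blast
      next
        case False
        from add[OF hhg Dm[OF g(1)] False] show ?thesis by simp
      qed
    qed
  qed
  show "\<forall>g\<in>D. \<forall>h\<in>D. g + h \<in> D"
  proof (intro ballI)
    fix g h assume "g \<in> D" "h \<in> D"
    show "g + h \<in> D"
    proof (cases "[g = h] (mod int k)")
      case True
      then have "[g + h = h + h] (mod int k)" by (intro cong_add) auto
      then show ?thesis using double[OF \<open>h \<in> D\<close>] periodicD[OF Dc] by blast
    qed (use add \<open>g \<in> D\<close> \<open>h \<in> D\<close> in blast)
  qed
qed

section \<open>Sets for which a whole subgroup is tight\<close>

lemma int_subgroup_principal:
  fixes D :: "int set"
  assumes k: "k > 0" "int k \<in> D" and add: "\<forall>g\<in>D. \<forall>h\<in>D. g + h \<in> D"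
    and um: "\<And>h. h \<in> D \<Longrightarrow> - h \<in> D"
  obtains d :: nat where "d > 0" "D = {x. int d dvd x}"
proof -
  define d where "d = (LEAST n :: nat. n > 0 \<and> int n \<in> D)"
  have d: "d > 0" "int d \<in> D"
    using LeastI[of "\<lambda>n :: nat. n > 0 \<and> int n \<in> D" k] k unfolding d_def by auto
  have least: "d \<le> n" if "n > 0" "int n \<in> D" for n
    unfolding d_def by (rule Least_le) (use that in simp)
  have zero: "0 \<in> D" using add d um by (metis add.right_inverse)
  have mult_nat: "int n * int d \<in> D" for n
    by (induction n) (use zero add d in \<open>auto simp: distrib_right\<close>)
  have mult: "q * int d \<in> D" for q
  proof (cases "q \<ge> 0")
    case True
    then show ?thesis using mult_nat[of "nat q"] by simp
  next
    case False
    then show ?thesis using um[OF mult_nat[of "nat (- q)"]] by simp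
  qed
  have "D = {x. int d dvd x}"
  proof (intro equalityI subsetI CollectI)
    fix x assume x: "x \<in> D"
    have "x + - (x div int d * int d) \<in> D" using add x um mult by blast
    then have m: "x mod int d \<in> D" by (simp add: minus_div_mult_eq_mod)
    show "int d dvd x"
    proof (rule ccontr)
      assume "\<not> int d dvd x"
      then have p: "x mod int d > 0"
        using d pos_mod_sign[of "int d" x] by (metis dvd_eq_mod_eq_0 of_nat_0_less_iff order_less_le)
      then have "int (nat (x mod int d)) = x mod int d" by simp
      then have "int d \<le> x mod int d"
        using least[of "nat (x mod int d)"] m p by (metis of_nat_le_iff zero_less_nat_eq)
      then show False using pos_mod_bound[of "int d" x] d by linarith
    qed
  next
    fix x assume "x \<in> {x. int d dvd x}"
    then show "x \<in> D" using mult by (auto simp: dvd_def mult.commute)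
  qed
  with d that show thesis by blast
qed

text \<open>The pairs \<open>(i, j)\<close> with \<open>c + i d \<in> A\<close> and \<open>c + j d \<notin> A\<close> have distinct nonzero
  differences \<open>j - i\<close> modulo \<open>l\<close>, so a coset of the subgroup generated by \<open>d\<close> meets \<open>- A\<close> in at
  most one or in at least \<open>l - 1\<close> residues.\<close>

lemma tight_coset_complement:
  assumes l: "l > 0" and d: "d > 0" and A: "periodic (d * l) A"
    and t: "\<And>h. int d dvd h \<Longrightarrow> tight (d * l) A h"
    and c: "c \<notin> A"
  shows "l - 1 \<le> dens (d * l) (- A) \<or> (\<forall>i. 0 < i \<and> i < l \<longrightarrow> c + int i * int d \<in> A)"
proof -
  define N where "N = {i. i < l \<and> c + int i * int d \<in> A}"
  define M where "M = {i. i < l \<and> c + int i * int d \<notin> A}"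
  have fin: "finite N" "finite M" by (auto simp: N_def M_def)
  have k: "d * l > 0" using l d by simp
  have "N \<union> M = {..<l}" "N \<inter> M = {}" by (auto simp: N_def M_def)
  then have NM: "card N + card M = l" using card_Un_disjoint[OF fin] by simp
  have eqI: "i = j" if "i < l" "j < l" "[x + int i * int d = x + int j * int d] (mod int (d * l))"
    for i j x
  proof -
    have "int (d * l) dvd int i * int d - int j * int d"
      using that(3) by (simp add: cong_add_lcancel cong_iff_dvd_diff)
    then have "int d * int l dvd int d * (int i - int j)" by (simp add: algebra_simps)
    then have "int l dvd int i - int j" using d by simp
    then have "[int i = int j] (mod int l)" by (simp add: cong_iff_dvd_diff)
    then show ?thesis using that by (simp add: cong_def)
  qed
  let ?g = "\<lambda>(i, j). (int j - int i) mod int l"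
  have g_inj: "inj_on ?g (N \<times> M)"
  proof (rule inj_onI, clarify)
    fix i j i' j'
    assume ij: "i \<in> N" "j \<in> M" "i' \<in> N" "j' \<in> M"
      and e: "(int j - int i) mod int l = (int j' - int i') mod int l"
    let ?h = "(int j - int i) * int d"
    have "int l dvd (int j - int i) - (int j' - int i')" using e by (simp add: mod_eq_dvd_iff)
    then have dv: "int (d * l) dvd ((int j - int i) - (int j' - int i')) * int d" by simp
    have 1: "c + int i * int d + ?h \<notin> A" using ij by (simp add: M_def algebra_simps)
    have "[c + int i' * int d + ?h = c + int j' * int d] (mod int (d * l))"
      using dv by (simp add: cong_iff_dvd_diff algebra_simps)
    then have 2: "c + int i' * int d + ?h \<notin> A" using periodicD[OF A] ij by (auto simp: M_def)
    \<comment> \<open>Both residues lie in \<open>A\<close> and leave it under the same multiple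
      \<open>?h\<close> of \<open>d\<close>, so tightness identifies them.\<close>
    have "[c + int i * int d = c + int i' * int d] (mod int (d * l))"
      using t[of ?h] 1 2 ij unfolding tight_def N_def by auto
    then have ii: "i = i'" using eqI ij by (auto simp: N_def)
    have "[int j - int i = int j' - int i] (mod int l)" using e ii by (simp add: cong_def)
    then have "[int j = int j'] (mod int l)" by (simp add: cong_iff_dvd_diff)
    then have "j = j'" using ij by (simp add: cong_def M_def)
    with ii show "i = i' \<and> j = j'" by simp
  qed
  have g_sub: "?g ` (N \<times> M) \<subseteq> {1..<int l}"
  proof clarify
    fix i j assume ij: "i \<in> N" "j \<in> M"
    then have "i \<noteq> j" by (auto simp: N_def M_def)
    then have "\<not> [int j = int i] (mod int l)"
      using ij by (simp add: N_def M_def cong_def)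
    then have "(int j - int i) mod int l \<noteq> 0"
      unfolding cong_iff_dvd_diff dvd_eq_mod_eq_0 .
    moreover have "0 \<le> (int j - int i) mod int l" "(int j - int i) mod int l < int l"
      using l by auto
    ultimately show "(int j - int i) mod int l \<in> {1..<int l}" by simp
  qed
  have "card (N \<times> M) \<le> card {1..<int l}" by (rule card_inj_on_le[OF g_inj g_sub]) simp
  then have le: "card N * card M \<le> l - 1" using l by (simp add: card_cartesian_product)
  \<comment> \<open>The two cardinalities add up to \<open>l\<close> and their product is at most
    \<open>l - 1\<close>, so (|N| - 1)(|M| - 1) <= 0.\<close>
  have "card M \<le> 1 \<or> l - 1 \<le> card M"
  proof (rule ccontr)
    assume "\<not> ?thesis"
    then have "card M = (card M - 2) + 2" "card N = (card N - 2) + 2" using NM by linarith+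
    then obtain a b where "card M = a + 2" "card N = b + 2" by blast
    with le NM show False by (auto simp: algebra_simps)
  qed
  then show ?thesis
  proof
    assume M1: "card M \<le> 1"
    have M0: "0 \<in> M" using c l by (simp add: M_def)
    have "i \<notin> M" if "0 < i" for i
    proof
      assume "i \<in> M"
      then have "card {0, i} \<le> card M" using M0 by (intro card_mono fin(2)) simp
      then show False using M1 that by simp
    qed
    then show ?thesis by (simp add: M_def)
  next
    assume big: "l - 1 \<le> card M"
    let ?F = "(\<lambda>i. c + int i * int d) ` M"
    have "inj_on (\<lambda>i. (c + int i * int d) mod int (d * l)) M"
      by (rule inj_onI) (use eqI in \<open>auto simp: M_def cong_def\<close>)
    then have inj: "inj_on (\<lambda>x. x mod int (d * l)) ?F" "inj_on (\<lambda>i. c + int i * int d) M"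
      by (auto simp: inj_on_def)
    have "card M = card ?F" using inj(2) by (simp add: card_image)
    also have "\<dots> \<le> dens (d * l) (- A)"
      by (rule card_le_dens[OF k periodic_Compl[OF A] _ _ inj(1)]) (auto simp: fin M_def)
    finally show ?thesis using big by simp
  qed
qed

text \<open>If fewer than \<open>l - 1\<close> residues are missing, each coset of the subgroup
  misses at most one. Then for every missing \<open>x\<close> the residue \<open>x - d\<close> of
  the same coset lies in \<open>A\<close> and leaves it under \<open>d\<close>; two missing residues
  contradict tightness of \<open>d\<close>.\<close>

lemma tight_subgroup_complement:
  assumes l: "l > 0" and d: "d > 0" and A: "periodic (d * l) A"
    and t: "\<And>h. int d dvd h \<Longrightarrow> tight (d * l) A h"
    and two: "2 \<le> dens (d * l) (- A)"
  shows "l - 1 \<le> dens (d * l) (- A)"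
proof (rule ccontr)
  assume small: "\<not> ?thesis"
  have "\<not> card (- A \<inter> {0..<int (d * l)}) \<le> Suc 0" using two by (simp add: dens_def)
  then obtain c c' where c: "c \<notin> A" "c' \<notin> A" "c \<in> {0..<int (d * l)}" "c' \<in> {0..<int (d * l)}" "c \<noteq> c'"
    using card_le_Suc0_iff_eq[of "- A \<inter> {0..<int (d * l)}"] by auto
  have l2: "l \<ge> 2" using small by linarith
  have *: "x - int d \<in> A" if "x \<notin> A" for x
  proof -
    have "x + int (l - 1) * int d \<in> A"
      using tight_coset_complement[OF l d A t that] small l2
      by (metis diff_less less_numeral_extra(1) l zero_less_diff order_less_le_trans one_less_numeral_iff semiring_norm(76))
    moreover have "[x + int (l - 1) * int d = x - int d] (mod int (d * l))"
      using l by (simp add: cong_iff_dvd_diff of_nat_diff algebra_simps)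
    ultimately show ?thesis using periodicD[OF A] by blast
  qed
  have "[c - int d = c' - int d] (mod int (d * l))"
    using t[of "int d"] *[OF c(1)] *[OF c(2)] c(1,2) unfolding tight_def by auto
  then have "[c = c'] (mod int (d * l))" by (simp add: cong_iff_dvd_diff)
  then show False using c by (simp add: cong_def)
qed

section \<open>Unions of translates by consecutive multiples of \<open>h\<close>\<close>

lemma dens_invariant:
  assumes l: "l > 0" and k: "k > 0" and E: "periodic k E" and e: "e \<in> E"
    and inv: "\<And>x. x \<in> E \<Longrightarrow> x - h \<in> E"
    and ord: "\<And>i :: int. int k dvd i * h \<Longrightarrow> int l dvd i"
  shows "l \<le> dens k E"
proof -
  \<comment> \<open>\<open>E\<close> contains the whole coset of \<open>e\<close> modulo the
    subgroup generated by \<open>h\<close>; by \<open>ord\<close> the order of \<open>h\<close> is a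
    multiple of \<open>l\<close>.\<close>
  have mem: "e - int i * h \<in> E" for i
  proof (induction i)
    case (Suc i)
    from inv[OF this] show ?case by (simp add: algebra_simps)
  qed (simp add: e)
  have inj: "inj_on (\<lambda>i. (e - int i * h) mod int k) {..<l}"
  proof (rule inj_onI)
    fix i j assume ij: "i \<in> {..<l}" "j \<in> {..<l}"
      and "(e - int i * h) mod int k = (e - int j * h) mod int k"
    then have "int k dvd (int j - int i) * h" by (simp add: mod_eq_dvd_iff algebra_simps)
    then have "[int j = int i] (mod int l)" using ord by (simp add: cong_iff_dvd_diff)
    then show "i = j" using ij by (simp add: cong_def)
  qed
  let ?F = "(\<lambda>i. e - int i * h) ` {..<l}"
  have inj': "inj_on (\<lambda>x. x mod int k) ?F" "inj_on (\<lambda>i. e - int i * h) {..<l}"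
    using inj by (auto simp: inj_on_def)
  have "l = card ?F" using inj'(2) by (simp add: card_image)
  also have "\<dots> \<le> dens k E" by (rule card_le_dens[OF k E _ _ inj'(1)]) (use mem in auto)
  finally show ?thesis .
qed

text \<open>Each further translate adds a residue until everything is covered: otherwise the
  nonempty complement of the union would be invariant under subtracting \<open>h\<close> and have at
  least \<open>l\<close> residues, more than \<open>A\<close> itself misses.\<close>

lemma dens_interval:
  assumes l: "l > 0" and k: "k > 0" and A: "periodic k A"
    and ord: "\<And>i :: int. int k dvd i * h \<Longrightarrow> int l dvd i"
    and small: "dens k (- A) < l"
  shows "min k (dens k A + j) \<le> dens k (\<Union>i\<le>j. translate (int i * h) A)"
proof (induction j)
  case 0
  then show ?case by (simp add: translate_def)
next
  case (Suc j)
  let ?B = "\<lambda>j. \<Union>i\<le>j. translate (int i * h) A"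
  have P: "periodic k (?B j)" for j
    using periodic_translate[OF A] unfolding periodic_def by blast
  have sub: "?B j \<subseteq> ?B (Suc j)" by (rule UN_mono) auto
  have AB: "A \<subseteq> ?B j" by (auto simp: translate_def)
  have step: "x + h \<in> ?B (Suc j)" if x: "x \<in> ?B j" for x
  proof -
    obtain i where "i \<le> j" "x - int i * h \<in> A" using x by (auto simp: translate_def)
    then have "Suc i \<le> Suc j" "x + h - int (Suc i) * h \<in> A" by (auto simp: algebra_simps)
    then show ?thesis unfolding translate_def by blast
  qed
  show ?case
  proof (cases "- ?B j = {}")
    case True
    then have "?B j = UNIV" by blast
    then have "?B (Suc j) = UNIV" using sub by blast
    then show ?thesis by (simp add: dens_def)
  next
    case False
    then obtain e where e: "e \<in> - ?B j" by blast
    have "dens k (- ?B j) \<le> dens k (- A)" by (rule dens_mono) (use AB in blast)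
    then have "\<not> l \<le> dens k (- ?B j)" using small by simp
    then obtain x where "x \<in> - ?B j" "x - h \<notin> - ?B j"
      using dens_invariant[OF l k periodic_Compl[OF P] e _ ord] by blast
    then have x: "x \<notin> ?B j" "x \<in> ?B (Suc j)" using step[of "x - h"] by auto
    have "dens k (?B j) + card {x} \<le> dens k (?B (Suc j))"
      by (rule dens_gain[OF k P P sub]) (use x in auto)
    then show ?thesis using Suc by simp
  qed
qed

section \<open>Paths and their weights\<close>

fun path_weight :: "('a \<Rightarrow> 'a \<Rightarrow> int) \<Rightarrow> 'a list \<Rightarrow> int" where
  "path_weight f (x # y # zs) = f x y + path_weight f (y # zs)"
| "path_weight f [x] = 0"
| "path_weight f [] = 0"

definition path_in :: "'a set \<Rightarrow> 'a list \<Rightarrow> bool" where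
  "path_in X xs \<longleftrightarrow> xs \<noteq> [] \<and> distinct xs \<and> set xs \<subseteq> X"

text \<open>The start is left free because paths inside the remaining vertices are entered from
  \<open>t\<close> at no cost once the potential is subtracted.\<close>

definition weights_to :: "('a \<Rightarrow> 'a \<Rightarrow> int) \<Rightarrow> 'a set \<Rightarrow> 'a \<Rightarrow> int set" where
  "weights_to f X w = {path_weight f ys | ys. path_in X ys \<and> last ys = w}"

lemma path_weight_append:
  "xs \<noteq> [] \<Longrightarrow> ys \<noteq> [] \<Longrightarrow>
    path_weight f (xs @ ys) = path_weight f xs + f (last xs) (hd ys) + path_weight f ys"
proof (induction f xs rule: path_weight.induct)
  case (2 f x)
  then show ?case by (cases ys) auto
qed auto

lemma path_weight_scale: "path_weight (\<lambda>x y. c * f x y) xs = c * path_weight f xs"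
  by (induction f xs rule: path_weight.induct) (auto simp: distrib_left)

text \<open>The potentials of the inner vertices telescope.\<close>

lemma path_weight_potential:
  "xs \<noteq> [] \<Longrightarrow> path_weight (\<lambda>x y. p x + f x y - p y) xs = p (hd xs) + path_weight f xs - p (last xs)"
  by (induction f xs rule: path_weight.induct) auto

lemma path_weight_mod_cong:
  assumes "\<And>x y. x \<in> set xs \<Longrightarrow> y \<in> set xs \<Longrightarrow> x \<noteq> y \<Longrightarrow> [f x y = g x y] (mod m)" "distinct xs"
  shows "[path_weight f xs = path_weight g xs] (mod m)"
  using assms by (induction f xs rule: path_weight.induct) (auto intro!: cong_add)

lemma path_weight_constant:
  "successively (\<lambda>x y. f x y = c) xs \<Longrightarrow> path_weight f xs = c * int (length xs - 1)"
  by (induction f xs rule: path_weight.induct) (auto simp: algebra_simps)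

text \<open>\<open>y\<close> goes in front of the first \<open>x\<close> with \<open>R y x\<close>,
  or to the end. The clause on \<open>hd zs\<close> is what allows the induction to put the removed
  first vertex back.\<close>

lemma successively_insert:
  assumes "successively R xs" "\<And>x. x \<in> set xs \<Longrightarrow> R x y \<or> R y x"
  shows "\<exists>zs. mset zs = mset (y # xs) \<and> successively R zs \<and>
    (hd zs = y \<or> xs \<noteq> [] \<and> hd zs = hd xs)"
  using assms
proof (induction xs)
  case Nil
  then show ?case by (intro exI[of _ "[y]"]) auto
next
  case (Cons x xs)
  show ?case
  proof (cases "R y x")
    case True
    then show ?thesis using Cons.prems by (intro exI[of _ "y # x # xs"]) auto
  next
    case False
    then have "R x y" using Cons.prems by auto
    obtain zs where zs: "mset zs = mset (y # xs)" "successively R zs"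
      "hd zs = y \<or> xs \<noteq> [] \<and> hd zs = hd xs"
      using Cons.IH Cons.prems by (auto simp: successively_Cons)
    have "zs \<noteq> []" using zs(1) by auto
    then have "successively R (x # zs)"
      using zs(2,3) \<open>R x y\<close> Cons.prems(1) by (auto simp: successively_Cons)
    then show ?thesis using zs(1) by (intro exI[of _ "x # zs"]) auto
  qed
qed

text \<open>Redei's theorem, with both directions between two vertices allowed.\<close>

lemma tournament_hamiltonian_path:
  assumes "finite X" "\<And>x y. x \<in> X \<Longrightarrow> y \<in> X \<Longrightarrow> x \<noteq> y \<Longrightarrow> R x y \<or> R y x"
  shows "\<exists>xs. set xs = X \<and> distinct xs \<and> successively R xs"
  using assms
proof (induction X)
  case (insert y X)
  then obtain xs where xs: "set xs = X" "distinct xs" "successively R xs" by auto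
  have "R x y \<or> R y x" if "x \<in> set xs" for x
    using insert.prems[of x y] insert.hyps that xs(1) by auto
  from successively_insert[OF xs(3) this]
  obtain zs where zs: "mset zs = mset (y # xs)" "successively R zs" by blast
  have "set zs = insert y X" using mset_eq_setD[OF zs(1)] xs(1) by simp
  moreover have "distinct zs"
    using mset_eq_imp_distinct_iff[OF zs(1)] xs insert by simp
  ultimately show ?case using zs(2) by blast
qed auto

text \<open>All final segments of \<open>xs\<close> end at the same vertex; the one with
  \<open>j\<close> arcs has weight \<open>c * j\<close>.\<close>

lemma weights_to_constant:
  assumes xs: "set xs = X" "distinct xs" "xs \<noteq> []" "successively (\<lambda>x y. f x y = c) xs"
    and j: "j < card X"
  shows "c * int j \<in> weights_to f X (last xs)"
proof -
  have len: "length xs = card X" using xs by (metis distinct_card)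
  let ?n = "card X - 1 - j"
  let ?ys = "drop ?n xs"
  have l: "length ?ys = Suc j" using len j by simp
  have "successively (\<lambda>x y. f x y = c) (take ?n xs @ ?ys)" using xs by simp
  then have "successively (\<lambda>x y. f x y = c) ?ys" unfolding successively_append_iff by blast
  then have "path_weight f ?ys = c * int j" using path_weight_constant l by fastforce
  moreover have "path_in X ?ys"
    using xs l set_drop_subset[of ?n xs] by (auto simp: path_in_def)
  moreover have "last ?ys = last xs" using l by (intro last_drop) auto
  ultimately show ?thesis unfolding weights_to_def by (metis (mono_tags, lifting) mem_Collect_eq)
qed

section \<open>Digraphs with arc weights -1, 0 and 1\<close>

text \<open>Since the trivial path has weight 0, the last two assumptions say that neither \<open>{-1..2}\<close>
  nor \<open>{-2..1}\<close> consists of weights of paths inside \<open>{v, w, x}\<close> ending at \<open>x\<close>.\<close>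

locale unit_weights =
  fixes U :: "'a set" and e :: "'a \<Rightarrow> 'a \<Rightarrow> int"
  assumes unit: "x \<in> U \<Longrightarrow> y \<in> U \<Longrightarrow> x \<noteq> y \<Longrightarrow> e x y \<in> {-1, 0, 1}"
    and no2: "x \<in> U \<Longrightarrow> y \<in> U \<Longrightarrow> x \<noteq> y \<Longrightarrow> e x y + e y x \<noteq> 0"
    and no3: "x \<in> U \<Longrightarrow> y \<in> U \<Longrightarrow> z \<in> U \<Longrightarrow> distinct [x, y, z] \<Longrightarrow> e x y + e y z + e z x \<noteq> 0"
    and no4: "x \<in> U \<Longrightarrow> y \<in> U \<Longrightarrow> z \<in> U \<Longrightarrow> w \<in> U \<Longrightarrow> distinct [x, y, z, w] \<Longrightarrow>
      e x y + e y z + e z w + e w x \<noteq> 0"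
    and spread1: "v \<in> U \<Longrightarrow> w \<in> U \<Longrightarrow> x \<in> U \<Longrightarrow> distinct [v, w, x] \<Longrightarrow>
      \<not> {-1, 1, 2} \<subseteq> {e v x, e w x, e v w + e w x, e w v + e v x}"
    and spread2: "v \<in> U \<Longrightarrow> w \<in> U \<Longrightarrow> x \<in> U \<Longrightarrow> distinct [v, w, x] \<Longrightarrow>
      \<not> {-2, -1, 1} \<subseteq> {e v x, e w x, e v w + e w x, e w v + e v x}"
begin

text \<open>By \<open>no2\<close> the pairs of vertices in \<open>U\<close> fall into two kinds:
  opposite arcs with weights in {0, 1}, or with weights in {-1, 0}, in neither case both 0.\<close>

definition positive :: "'a \<Rightarrow> 'a \<Rightarrow> bool" where
  "positive x y \<longleftrightarrow> e x y + e y x > 0"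

lemma positive_sym: "positive x y \<longleftrightarrow> positive y x"
  by (simp add: positive_def add.commute)

text \<open>Negation exchanges \<open>spread1\<close> and \<open>spread2\<close>, so each fact about
  positive pairs has a mirror image.\<close>

lemma uminus_unit_weights: "unit_weights U (\<lambda>x y. - e x y)"
proof
  fix v w x assume "v \<in> U" "w \<in> U" "x \<in> U" "distinct [v, w, x]"
  then show "\<not> {-1, 1, 2} \<subseteq> {- e v x, - e w x, - e v w + - e w x, - e w v + - e v x}"
    "\<not> {-2, -1, 1} \<subseteq> {- e v x, - e w x, - e v w + - e w x, - e w v + - e v x}"
    using spread1[of v w x] spread2[of v w x] by (smt (verit, ccfv_threshold) insert_iff insert_subset empty_subsetI empty_iff)+
next
  show "- e x y \<in> {-1, 0, 1}" if "x \<in> U" "y \<in> U" "x \<noteq> y" for x y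
    using unit[OF that] by auto
  show "- e x y + - e y x \<noteq> 0" if "x \<in> U" "y \<in> U" "x \<noteq> y" for x y
    using no2[OF that] by auto
  show "- e x y + - e y z + - e z x \<noteq> 0" if "x \<in> U" "y \<in> U" "z \<in> U" "distinct [x, y, z]" for x y z
    using no3[OF that] by auto
  show "- e x y + - e y z + - e z w + - e w x \<noteq> 0"
    if "x \<in> U" "y \<in> U" "z \<in> U" "w \<in> U" "distinct [x, y, z, w]" for x y z w
    using no4[OF that] by auto
qed

text \<open>The triangle through \<open>v\<close>, \<open>w\<close>, \<open>x\<close> in this order
  makes \<open>e v w\<close> and \<open>e x v\<close> equal; if both were 0, the paths ending at
  \<open>x\<close> would violate \<open>spread1\<close>. The paths ending at \<open>w\<close> then
  exclude \<open>e x w = -1\<close>, and \<open>spread1\<close> with the reverse triangle leaves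
  exactly one of \<open>e v x\<close>, \<open>e w v\<close> equal to 1.\<close>

lemma mixed_triple:
  assumes U: "v \<in> U" "w \<in> U" "x \<in> U" "distinct [v, w, x]"
    and p: "positive v w" "positive v x" "\<not> positive w x" and wx: "e w x = -1"
  shows "e x w = 0 \<and> e x v = 1 \<and> e v w = 1 \<and> e v x + e w v = 1"
proof -
  have u: "e v w = 0 \<or> e v w = 1" "e w v = 0 \<or> e w v = 1" "e v x = 0 \<or> e v x = 1"
    "e x v = 0 \<or> e x v = 1" "e x w = 0 \<or> e x w = -1"
    using unit[of v w] unit[of w v] unit[of v x] unit[of x v] unit[of x w] no2[of w x] U p wx
    by (auto simp: positive_def)
  have z: "e v w + e w x + e x v \<noteq> 0" "e v x + e x w + e w v \<noteq> 0"
    using no3[of v w x] no3[of v x w] U by auto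
  have s: "\<not> {-1, 1, 2} \<subseteq> {e v x, e w x, e v w + e w x, e w v + e v x}"
    "\<not> {-1, 1, 2} \<subseteq> {e v w, e x w, e v x + e x w, e x v + e v w}"
    using spread1[of v w x] spread1[of v x w] U by auto
  have 1: "e v w = 1" "e x v = 1"
  proof -
    have "\<not> (e v w = 0 \<and> e x v = 0)"
    proof
      assume "e v w = 0 \<and> e x v = 0"
      then have "e w v = 1" "e v x = 1" using u p by (auto simp: positive_def)
      then show False using s(1) wx by simp
    qed
    then show "e v w = 1" "e x v = 1" using z(1) u wx by auto
  qed
  have "e x w \<noteq> -1" using s(2) 1 by auto
  moreover have "\<not> (e v x = 1 \<and> e w v = 1)" using s(1) wx by auto
  ultimately show ?thesis using 1 u z(2) by auto
qed

lemma mixed_triple_disj: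
  assumes U: "v \<in> U" "w \<in> U" "x \<in> U" "distinct [v, w, x]"
    and p: "positive v w" "positive v x" "\<not> positive w x"
  shows "e w x = -1 \<and> e x w = 0 \<and> e x v = 1 \<and> e v w = 1 \<and> e v x + e w v = 1 \<or>
    e x w = -1 \<and> e w x = 0 \<and> e w v = 1 \<and> e v x = 1 \<and> e v w + e x v = 1"
proof -
  have "e w x = -1 \<or> e x w = -1"
    using unit[of w x] unit[of x w] no2[of w x] U p by (auto simp: positive_def)
  then show ?thesis
    using mixed_triple[of v w x] mixed_triple[of v x w] U p positive_sym by auto
qed

lemma mixed_triple_disj_neg:
  assumes U: "v \<in> U" "w \<in> U" "x \<in> U" "distinct [v, w, x]"
    and p: "\<not> positive v w" "\<not> positive v x" "positive w x"
  shows "e w x = 1 \<and> e x w = 0 \<and> e x v = -1 \<and> e v w = -1 \<and> e v x + e w v = -1 \<or>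
    e x w = 1 \<and> e w x = 0 \<and> e w v = -1 \<and> e v x = -1 \<and> e v w + e x v = -1"
proof -
  interpret neg: unit_weights U "\<lambda>x y. - e x y" by (rule uminus_unit_weights)
  have "neg.positive v w" "neg.positive v x" "\<not> neg.positive w x"
    using p no2[of v w] no2[of v x] U by (auto simp: positive_def neg.positive_def)
  from neg.mixed_triple_disj[OF U this] show ?thesis by auto
qed

text \<open>These sums do not depend on which of the two orientations occurs, so they settle many
  sign patterns by arithmetic alone.\<close>

lemma mixed_triple_sum:
  assumes "v \<in> U" "w \<in> U" "x \<in> U" "distinct [v, w, x]"
  shows "positive v w \<Longrightarrow> positive v x \<Longrightarrow> \<not> positive w x \<Longrightarrow>
      e v w + e w v + e v x + e x v = 3 \<and> e w x + e x w = -1"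
    and "\<not> positive v w \<Longrightarrow> \<not> positive v x \<Longrightarrow> positive w x \<Longrightarrow>
      e v w + e w v + e v x + e x v = -3 \<and> e w x + e x w = 1"
  using mixed_triple_disj[OF assms] mixed_triple_disj_neg[OF assms] by linarith+

text \<open>A fourth vertex creates no second negative pair. The sums of mixed triples refute the
  sign patterns 2, 3, 4 and 8; the patterns 5, 6 and 7 also need the exact weights and the
  4-cycles.\<close>

lemma mixed_triple_unique:
  assumes U: "v \<in> U" "w \<in> U" "x \<in> U" "y \<in> U" "distinct [v, w, x, y]"
    and p: "positive v w" "positive v x" "\<not> positive w x" and wx: "e w x = -1"
  shows "positive y v \<and> positive y w \<and> positive y x"
proof -
  note T = mixed_triple_disj and N = mixed_triple_disj_neg
  note ST = mixed_triple_sum(1) and SN = mixed_triple_sum(2)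
  have vwx: "e x w = 0" "e x v = 1" "e v w = 1" "e v x + e w v = 1"
    using mixed_triple[OF U(1-3) _ p wx] U by auto
  have sym: "positive v y = positive y v" "positive w y = positive y w" "positive x y = positive y x"
    "positive w v" "positive x v" "\<not> positive x w"
    using p positive_sym by auto
  \<comment> \<open>These are the six directed 4-cycles through \<open>v\<close>, \<open>w\<close>,
    \<open>x\<close>, \<open>y\<close>.\<close>
  have F: "e w x + e x y + e y v + e v w \<noteq> 0" "e w x + e x v + e v y + e y w \<noteq> 0"
    "e w v + e v x + e x y + e y w \<noteq> 0" "e w y + e y x + e x v + e v w \<noteq> 0"
    "e w y + e y v + e v x + e x w \<noteq> 0" "e w v + e v y + e y x + e x w \<noteq> 0"
    using no4[of w x y v] no4[of w x v y] no4[of w v x y] no4[of w y x v] no4[of w y v x]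
      no4[of w v y x] U by auto
  consider "positive y v" "positive y w" "positive y x"
    | (2) "positive y v" "positive y w" "\<not> positive y x"
    | (3) "positive y v" "\<not> positive y w" "positive y x"
    | (4) "positive y v" "\<not> positive y w" "\<not> positive y x"
    | (5) "\<not> positive y v" "positive y w" "positive y x"
    | (6) "\<not> positive y v" "positive y w" "\<not> positive y x"
    | (7) "\<not> positive y v" "\<not> positive y w" "positive y x"
    | (8) "\<not> positive y v" "\<not> positive y w" "\<not> positive y x" by blast
  then show ?thesis
  proof cases
    case 2
    then have "e x w + e w x + e x y + e y x = -3" "e x y + e y x = -1"
      using SN[of x w y] ST[of v x y] U p sym by auto
    then show ?thesis using vwx wx by simp
  next
    case 3
    then have "e w x + e x w + e w y + e y w = -3" "e w y + e y w = -1"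
      using SN[of w x y] ST[of v w y] U p sym by auto
    then show ?thesis using vwx wx by simp
  next
    case 4
    \<comment> \<open>Three pair weights with all pairwise sums equal to 3 would have a total of
      9/2.\<close>
    then have "e v w + e w v + e v y + e y v = 3" "e v x + e x v + e v y + e y v = 3"
      "e v w + e w v + e v x + e x v = 3"
      using ST[of v w y] ST[of v x y] ST[of v w x] U p sym by auto
    then show ?thesis by presburger
  next
    case 5
    then show ?thesis
      using T[of y w x] T[of w v y] T[of x v y] U p sym wx vwx F(1,2)
      by auto
  next
    case 6
    then show ?thesis
      using N[of y v x] T[of w v y] N[of x w y] U p sym wx vwx F
      by auto
  next
    case 7
    then show ?thesis
      using N[of y v w] T[of x v y] N[of w x y] U p sym wx vwx F
      by auto
  next
    case 8
    then have "e v w + e w v = 1" "e v x + e x v = 1" "e v w + e w v + e v x + e x v = 3"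
      using SN[of y v w] SN[of y v x] ST[of v w x] U p sym by auto
    then show ?thesis by simp
  qed blast
qed

text \<open>Every other vertex \<open>y\<close> is the centre of a mixed triple with
  \<open>w\<close> and \<open>x\<close>, so for \<open>e w x = -1\<close> the arcs from
  \<open>x\<close> to \<open>y\<close> and from \<open>y\<close> to \<open>w\<close> have weight 1.
  All pairs among the other vertices are positive, so Redei's theorem gives a path through them,
  which \<open>x\<close> starts and \<open>w\<close> ends.\<close>

lemma mixed_triple_hamiltonian_path:
  assumes fin: "finite U" and U: "v \<in> U" "w \<in> U" "x \<in> U" "distinct [v, w, x]"
    and p: "positive v w" "positive v x" "\<not> positive w x"
  obtains xs where "set xs = U" "distinct xs" "xs \<noteq> []" "successively (\<lambda>x y. e x y = 1) xs"
proof -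
  note hyp = that
  have *: thesis if U: "v \<in> U" "w \<in> U" "x \<in> U" "distinct [v, w, x]"
    and p: "positive v w" "positive v x" "\<not> positive w x" and wx: "e w x = -1" for v w x
  proof -
    let ?V = "U - {w, x}"
    have pos_wx: "positive y w \<and> positive y x" if "y \<in> ?V" for y
    proof (cases "y = v")
      case False
      then have "distinct [v, w, x, y]" using U that by auto
      then show ?thesis using mixed_triple_unique[OF U(1-3) _ _ p wx] that by blast
    qed (use p in simp)
    have to: "e x y = 1" "e y w = 1" if y: "y \<in> ?V" for y
      using mixed_triple[of y w x] pos_wx[OF y] y U(2,3,4) p(3) wx by auto
    have tour: "e y z = 1 \<or> e z y = 1" if yz: "y \<in> ?V" "z \<in> ?V" "y \<noteq> z" for y z
    proof -
      have "distinct [y, w, x, z]" using yz U by auto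
      then have "positive z y"
        using mixed_triple_unique[of y w x z] pos_wx[OF yz(1)] yz U(2,3) p(3) wx by blast
      then show ?thesis using unit[of y z] unit[of z y] yz by (auto simp: positive_def)
    qed
    have "finite ?V" using fin by simp
    from tournament_hamiltonian_path[OF this, of "\<lambda>x y. e x y = 1", OF tour]
    obtain zs where zs: "set zs = ?V" "distinct zs" "successively (\<lambda>x y. e x y = 1) zs"
      by blast
    have "v \<in> set zs" unfolding zs(1) using U by simp
    then have ne: "zs \<noteq> []" by auto
    then have "hd zs \<in> ?V" "last zs \<in> ?V" unfolding zs(1)[symmetric] by simp_all
    then have "successively (\<lambda>x y. e x y = 1) (x # zs @ [w])"
      using ne zs(3) to by (simp add: successively_Cons successively_append_iff)
    moreover have "set (x # zs @ [w]) = U" using U by (auto simp: zs(1))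
    moreover have "distinct (x # zs @ [w])" using U by (auto simp: zs)
    ultimately show thesis by (intro hyp) simp_all
  qed
  have "e w x = -1 \<or> e x w = -1" using mixed_triple_disj[OF U p] by blast
  then show thesis
    using *[OF U p] *[of v x w] U p positive_sym[of w x] by auto
qed

text \<open>If all pairs have the same sign, Redei's theorem suffices. Otherwise some vertex lies in
  pairs of both signs, and the third pair of that triple decides whether the mixed triple is used
  directly or negated.\<close>

lemma hamiltonian_constant_path:
  assumes fin: "finite U" and ne: "U \<noteq> {}"
  obtains c xs where "c = 1 \<or> c = -1" "set xs = U" "distinct xs" "xs \<noteq> []"
    "successively (\<lambda>x y. e x y = c) xs"
proof -
  note hyp = that
  have *: thesis if "\<And>x y. x \<in> U \<Longrightarrow> y \<in> U \<Longrightarrow> x \<noteq> y \<Longrightarrow> e x y = c \<or> e y x = c" "c = 1 \<or> c = -1" for c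
  proof -
    note that' = that
    obtain xs where xs: "set xs = U" "distinct xs" "successively (\<lambda>x y. e x y = c) xs"
      using tournament_hamiltonian_path[OF fin, of "\<lambda>x y. e x y = c"] that'(1) by blast
    have "xs \<noteq> []" using xs(1) ne by auto
    with xs that(2) show thesis by (intro hyp)
  qed
  consider (pos) "\<And>x y. x \<in> U \<Longrightarrow> y \<in> U \<Longrightarrow> x \<noteq> y \<Longrightarrow> positive x y"
    | (neg) "\<And>x y. x \<in> U \<Longrightarrow> y \<in> U \<Longrightarrow> x \<noteq> y \<Longrightarrow> \<not> positive x y"
    | (mixed) a b c d where "a \<in> U" "b \<in> U" "a \<noteq> b" "positive a b"
        "c \<in> U" "d \<in> U" "c \<noteq> d" "\<not> positive c d" by blast
  then show thesis
  proof cases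
    case pos
    have "e x y = 1 \<or> e y x = 1" if "x \<in> U" "y \<in> U" "x \<noteq> y" for x y
      using pos[OF that] unit[of x y] unit[of y x] that by (auto simp: positive_def)
    then show thesis using *[of 1] by blast
  next
    case neg
    have "e x y = -1 \<or> e y x = -1" if "x \<in> U" "y \<in> U" "x \<noteq> y" for x y
      using neg[OF that] unit[of x y] unit[of y x] no2[of x y] that by (auto simp: positive_def)
    then show thesis using *[of "-1"] by blast
  next
    case mixed
    \<comment> \<open>If each vertex saw only one sign, the sign would spread from \<open>a\<close>,
      \<open>b\<close> to all pairs.\<close>
    have "\<exists>p q r. p \<in> U \<and> q \<in> U \<and> r \<in> U \<and> distinct [p, q, r] \<and> positive p q \<and> \<not> positive p r"
    proof (rule ccontr)
      assume none: "\<not> ?thesis"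
      have pos: "positive p r" if "p \<in> U" "q \<in> U" "r \<in> U" "p \<noteq> q" "p \<noteq> r" "positive p q" for p q r
        using none that by (cases "q = r") auto
      have "positive a c" if "a \<noteq> c" using pos[of a b c] mixed that by blast
      then have "positive c d"
        using pos[of c a d] pos[of a b d] mixed positive_sym by blast
      with mixed show False by blast
    qed
    then obtain p q r where pqr: "p \<in> U" "q \<in> U" "r \<in> U" "distinct [p, q, r]" "positive p q"
      "\<not> positive p r" by blast
    show thesis
    proof (cases "positive q r")
      case True
      then obtain xs where "set xs = U" "distinct xs" "xs \<noteq> []" "successively (\<lambda>x y. e x y = 1) xs"
        using mixed_triple_hamiltonian_path[OF fin, of q p r] pqr positive_sym by auto
      then show thesis using that[of 1] by blast
    next
      case False
      interpret neg: unit_weights U "\<lambda>x y. - e x y" by (rule uminus_unit_weights)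
      have "neg.positive r q" "neg.positive r p" "\<not> neg.positive q p"
        using False pqr no2[of r q] no2[of r p] by (auto simp: positive_def neg.positive_def)
      then obtain xs where xs: "set xs = U" "distinct xs" "xs \<noteq> []"
          "successively (\<lambda>x y. - e x y = 1) xs"
        using neg.mixed_triple_hamiltonian_path[OF fin, of r q p] pqr by auto
      have "(\<lambda>x y. - e x y = 1) = (\<lambda>x y. e x y = -1)" by (auto simp: fun_eq_iff)
      then show thesis using that[of "-1"] xs by simp
    qed
  qed
qed

lemma interval_weights:
  assumes fin: "finite U" and ne: "U \<noteq> {}"
  obtains w i where "w \<in> U" "{i..i + int (card U) - 1} \<subseteq> weights_to e U w"
proof -
  obtain c xs where c: "c = 1 \<or> c = -1" and xs: "set xs = U" "distinct xs" "xs \<noteq> []"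
    "successively (\<lambda>x y. e x y = c) xs"
    by (rule hamiltonian_constant_path[OF fin ne])
  have w: "c * int j \<in> weights_to e U (last xs)" if "j < card U" for j
    by (rule weights_to_constant[OF xs that])
  let ?i = "if c = 1 then 0 else 1 - int (card U)"
  have "{?i..?i + int (card U) - 1} \<subseteq> weights_to e U (last xs)"
  proof
    fix x assume x: "x \<in> {?i..?i + int (card U) - 1}"
    then have "nat \<bar>x\<bar> < card U" "c * int (nat \<bar>x\<bar>) = x" using c by (auto split: if_splits)
    then show "x \<in> weights_to e U (last xs)" using w[of "nat \<bar>x\<bar>"] by simp
  qed
  moreover have "last xs \<in> U" using xs by auto
  ultimately show thesis using that by blast
qed

end

section \<open>Zero-sum cycles\<close>

definition zero_cycle :: "nat \<Rightarrow> ('a \<Rightarrow> 'a \<Rightarrow> int) \<Rightarrow> 'a set \<Rightarrow> bool" where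
  "zero_cycle k f V \<longleftrightarrow>
     (\<exists>xs. path_in V xs \<and> 2 \<le> length xs \<and> int k dvd path_weight f xs + f (last xs) (hd xs))"

definition residues_between ::
  "nat \<Rightarrow> ('a \<Rightarrow> 'a \<Rightarrow> int) \<Rightarrow> 'a set \<Rightarrow> 'a \<Rightarrow> 'a \<Rightarrow> int set" where
  "residues_between k f S s t =
     {x. \<exists>xs. path_in S xs \<and> hd xs = s \<and> last xs = t \<and> [x = path_weight f xs] (mod int k)}"

lemma zero_cycle_mono: "zero_cycle k f U \<Longrightarrow> U \<subseteq> V \<Longrightarrow> zero_cycle k f V"
  unfolding zero_cycle_def path_in_def by blast

lemma periodic_residues_between: "periodic k (residues_between k f S s t)"
  unfolding periodic_def residues_between_def by (blast intro: cong_trans cong_sym)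

lemma hd_neq_last: "distinct xs \<Longrightarrow> 2 \<le> length xs \<Longrightarrow> hd xs \<noteq> last xs"
  by (cases xs) auto

text \<open>Potentials cancel around a cycle. The factor \<open>c\<close> serves two purposes:
  dividing all weights by a common divisor, and replacing the weights \<open>0\<close>,
  \<open>h\<close>, \<open>-h\<close> by 0, 1, -1.\<close>

lemma zero_cycle_potential:
  assumes g: "\<And>x y. x \<in> V \<Longrightarrow> y \<in> V \<Longrightarrow> x \<noteq> y \<Longrightarrow> [p x + f x y - p y = c * g x y] (mod int k)"
    and xs: "path_in V xs" "2 \<le> length xs"
    and dvd: "int k dvd c * (path_weight g xs + g (last xs) (hd xs))"
  shows "zero_cycle k f V"
proof -
  have xs': "xs \<noteq> []" "distinct xs" "set xs \<subseteq> V" using xs by (auto simp: path_in_def)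
  have "[path_weight (\<lambda>x y. p x + f x y - p y) xs = path_weight (\<lambda>x y. c * g x y) xs] (mod int k)"
    by (rule path_weight_mod_cong) (use xs' g in auto)
  then have "[p (hd xs) + path_weight f xs - p (last xs) = c * path_weight g xs] (mod int k)"
    using xs' by (simp add: path_weight_potential path_weight_scale)
  moreover have "[p (last xs) + f (last xs) (hd xs) - p (hd xs) = c * g (last xs) (hd xs)] (mod int k)"
    by (rule g) (use xs' hd_neq_last[OF xs'(2) xs(2)] in auto)
  ultimately have "[(p (hd xs) + path_weight f xs - p (last xs))
      + (p (last xs) + f (last xs) (hd xs) - p (hd xs))
      = c * path_weight g xs + c * g (last xs) (hd xs)] (mod int k)"
    by (rule cong_add)
  then have "[path_weight f xs + f (last xs) (hd xs) = c * (path_weight g xs + g (last xs) (hd xs))] (mod int k)"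
    by (simp add: algebra_simps)
  then have "int k dvd path_weight f xs + f (last xs) (hd xs)"
    using dvd cong_dvd_iff by blast
  then show ?thesis using xs unfolding zero_cycle_def by blast
qed

text \<open>Some path from \<open>s\<close> to \<open>w\<close> has weight \<open>- f w s\<close>,
  and the arc from \<open>w\<close> to \<open>s\<close> closes it.\<close>

lemma zero_cycle_full:
  assumes "k > 0" "s \<noteq> w" "k \<le> dens k (residues_between k f V s w)"
  shows "zero_cycle k f V"
proof -
  have "- f w s \<in> residues_between k f V s w"
    by (rule dens_eq_full) (use assms periodic_residues_between in auto)
  then obtain xs where xs: "path_in V xs" "hd xs = s" "last xs = w"
    "[- f w s = path_weight f xs] (mod int k)"
    by (auto simp: residues_between_def)
  have "int k dvd path_weight f xs + f w s"
    using cong_sym[OF xs(4)] by (simp add: cong_iff_dvd_diff)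
  moreover have "2 \<le> length xs"
    using xs assms(2) by (cases xs; cases "tl xs") (auto simp: path_in_def)
  ultimately show ?thesis using xs unfolding zero_cycle_def by blast
qed

section \<open>A largest vertex set realising many residues\<close>

locale extremal =
  fixes k :: nat and f :: "'a \<Rightarrow> 'a \<Rightarrow> int" and V S :: "'a set" and s t :: 'a
  assumes k: "k > 0" and fin: "finite V" and no_cycle: "\<not> zero_cycle k f V"
    and S: "S \<subseteq> V" "s \<in> S"
    and S_dens: "card S \<le> dens k (residues_between k f S s t) + 1"
    and max: "\<And>S' s' t'. S' \<subseteq> V \<Longrightarrow> s' \<in> S' \<Longrightarrow>
      card S' \<le> dens k (residues_between k f S' s' t') + 1 \<Longrightarrow> card S' \<le> card S"
begin

definition A :: "int set" where
  "A = residues_between k f S s t"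

definition U :: "'a set" where
  "U = V - S"

text \<open>With the potential \<open>f t\<close>, stepping from \<open>t\<close> into a path
  \<open>ys\<close> and following it to its end \<open>w\<close> costs
  \<open>path_weight g ys + f t w\<close>. The start of \<open>ys\<close> no longer matters, and
  \<open>f t w\<close> is a mere translation for fixed \<open>w\<close>.\<close>

definition g :: "'a \<Rightarrow> 'a \<Rightarrow> int" where
  "g x y = f t x + f x y - f t y"

lemma per: "periodic k A"
  unfolding A_def by (rule periodic_residues_between)

lemma extend_paths:
  assumes X: "X \<subseteq> U"
  shows "translate (f t w) (\<Union>\<tau>\<in>weights_to g X w. translate \<tau> A) \<subseteq> residues_between k f (S \<union> X) s w"
proof
  fix x assume "x \<in> translate (f t w) (\<Union>\<tau>\<in>weights_to g X w. translate \<tau> A)"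
  then obtain ys where ys: "path_in X ys" "last ys = w" "x - f t w - path_weight g ys \<in> A"
    by (auto simp: translate_def weights_to_def)
  then obtain xs where xs: "path_in S xs" "hd xs = s" "last xs = t"
    "[x - f t w - path_weight g ys = path_weight f xs] (mod int k)"
    by (auto simp: A_def residues_between_def)
  have ne: "xs \<noteq> []" "ys \<noteq> []" using xs ys by (auto simp: path_in_def)
  have "path_weight g ys = f t (hd ys) + path_weight f ys - f t w"
    using path_weight_potential[OF ne(2), of "f t" f] ys(2) unfolding g_def[abs_def] by simp
  then have "path_weight f (xs @ ys) = path_weight f xs + (f t w + path_weight g ys)"
    using ne xs by (simp add: path_weight_append)
  moreover have "[x - f t w - path_weight g ys + (f t w + path_weight g ys)
      = path_weight f xs + (f t w + path_weight g ys)] (mod int k)"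
    by (rule cong_add) (use xs(4) in auto)
  ultimately have "[x = path_weight f (xs @ ys)] (mod int k)" by simp
  moreover have "path_in (S \<union> X) (xs @ ys)"
    using xs(1) ys(1) X by (auto simp: path_in_def U_def)
  moreover have "hd (xs @ ys) = s" "last (xs @ ys) = w" using ne xs ys by auto
  ultimately show "x \<in> residues_between k f (S \<union> X) s w"
    unfolding residues_between_def by blast
qed

text \<open>All residues would close up to a zero-sum cycle through the arc from \<open>w\<close> to
  \<open>s\<close>. A gain of \<open>card X\<close> residues would make \<open>S\<close> together
  with \<open>X\<close>, with ends \<open>s\<close> and \<open>w\<close>, a larger admissible set
  than \<open>S\<close>.\<close>

lemma extension_bound:
  assumes X: "X \<subseteq> U" and w: "w \<in> X" and B: "B \<subseteq> (\<Union>\<tau>\<in>weights_to g X w. translate \<tau> A)"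
  shows "dens k B < k" "dens k B < dens k A + card X"
proof -
  let ?B = "\<Union>\<tau>\<in>weights_to g X w. translate \<tau> A"
  have per_B: "periodic k ?B"
    using periodic_translate[OF per] unfolding periodic_def by blast
  have "dens k B \<le> dens k ?B" by (rule dens_mono[OF B])
  also have "\<dots> = dens k (translate (f t w) ?B)" by (rule dens_translate[OF k per_B, symmetric])
  also have "\<dots> \<le> dens k (residues_between k f (S \<union> X) s w)"
    by (rule dens_mono[OF extend_paths[OF X]])
  finally have le: "dens k B \<le> dens k (residues_between k f (S \<union> X) s w)" .
  have sub: "S \<union> X \<subseteq> V" using S X by (auto simp: U_def)
  have "w \<noteq> s" using w X S by (auto simp: U_def)
  then have "\<not> k \<le> dens k (residues_between k f (S \<union> X) s w)"
    using zero_cycle_full[OF k, of s w f "S \<union> X"] zero_cycle_mono[OF _ sub] no_cycle by blast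
  then show "dens k B < k" using le by simp
  have finX: "finite X" "finite S" using sub fin finite_subset by auto
  have card: "card (S \<union> X) = card S + card X"
    by (rule card_Un_disjoint) (use finX X in \<open>auto simp: U_def\<close>)
  have pos: "card X > 0" using w finX by (auto simp: card_gt_0_iff)
  show "dens k B < dens k A + card X"
  proof (rule ccontr)
    assume "\<not> ?thesis"
    then have "card (S \<union> X) \<le> dens k (residues_between k f (S \<union> X) s w) + 1"
      using le S_dens card unfolding A_def by simp
    from max[OF sub _ this] S(2) card pos show False by simp
  qed
qed

lemma dens_less:
  assumes "v \<in> U"
  shows "dens k A < k"
proof (rule extension_bound(1)[of "{v}" v])
  have "path_in {v} [v]" "last [v] = v" "path_weight g [v] = 0" by (auto simp: path_in_def)
  then have "0 \<in> weights_to g {v} v" unfolding weights_to_def by force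
  then show "A \<subseteq> (\<Union>\<tau>\<in>weights_to g {v} v. translate \<tau> A)" by (force simp: translate_def)
qed (use assms in auto)

lemma pair_bound:
  assumes v: "v \<in> U" "w \<in> U" "v \<noteq> w"
  shows "dens k (A \<union> translate (g v w) A) < k" "dens k (A \<union> translate (g v w) A) < dens k A + 2"
proof -
  have "path_in {v, w} [w]" "last [w] = w" "path_weight g [w] = 0" by (auto simp: path_in_def)
  then have 1: "0 \<in> weights_to g {v, w} w" unfolding weights_to_def by force
  have "path_in {v, w} [v, w]" "last [v, w] = w" "path_weight g [v, w] = g v w"
    using v by (auto simp: path_in_def)
  then have 2: "g v w \<in> weights_to g {v, w} w" unfolding weights_to_def by force
  have "A \<union> translate (g v w) A \<subseteq> (\<Union>\<tau>\<in>weights_to g {v, w} w. translate \<tau> A)"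
    using 1 2 by (force simp: translate_def)
  from extension_bound[OF _ _ this] v
  show "dens k (A \<union> translate (g v w) A) < k" "dens k (A \<union> translate (g v w) A) < dens k A + 2"
    by auto
qed

lemma pair_tight:
  assumes "v \<in> U" "w \<in> U" "v \<noteq> w"
  shows "tight k A (g v w)"
  using pair_bound(2)[OF assms] not_tight_gain[OF k per, of "g v w"] by linarith

text \<open>A weight that is nonzero modulo \<open>k\<close> shifts some residue of \<open>A\<close>
  onto the single missing one, and all residues would be reached.\<close>

lemma pair_dvd:
  assumes v: "v \<in> U" "w \<in> U" "v \<noteq> w" and one: "dens k (- A) \<le> 1"
  shows "int k dvd g v w"
proof (rule ccontr)
  assume nd: "\<not> int k dvd g v w"
  have "dens k A < k" using dens_less v by blast
  then have "dens k (- A) \<noteq> 0" using dens_Compl[of k A] by simp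
  then obtain c where c: "c \<notin> A" unfolding dens_def by (metis Compl_iff Int_emptyI card.empty)
  have "c - g v w \<in> A"
  proof (rule ccontr)
    assume "c - g v w \<notin> A"
    have inc: "\<not> [c = c - g v w] (mod int k)" using nd by (simp add: cong_iff_dvd_diff)
    then have "c \<noteq> c - g v w" by auto
    then have "card {c, c - g v w} = 2" by simp
    moreover have "card {c, c - g v w} \<le> dens k (- A)"
      using card_le_dens[OF k periodic_Compl[OF per] _ _ inj_mod_pair[OF inc]] c \<open>c - g v w \<notin> A\<close> by simp
    ultimately show False using one by simp
  qed
  then have "c \<in> translate (g v w) A" by (simp add: translate_def)
  then have "dens k A + card {c} \<le> dens k (A \<union> translate (g v w) A)"
    using c by (intro dens_gain[OF k per periodic_Un[OF per periodic_translate[OF per]]]) auto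
  then show False using pair_bound(1)[OF v] one dens_Compl[of k A] by simp
qed

text \<open>Dividing by \<open>h\<close> turns the weights into 0, 1, -1. The extremal choice of
  \<open>S\<close> yields the assumptions of \<open>unit_weights\<close>, and the resulting long
  interval of path weights covers all missing residues.\<close>

lemma no_unit_weights:
  assumes l: "l > 0" and ord: "\<And>i :: int. int k dvd i * h \<Longrightarrow> int l dvd i"
    and small: "dens k (- A) < l" "dens k (- A) < card U"
    and pm: "\<And>x y. x \<in> U \<Longrightarrow> y \<in> U \<Longrightarrow> x \<noteq> y \<Longrightarrow>
      [g x y = 0] (mod int k) \<or> [g x y = h] (mod int k) \<or> [g x y = - h] (mod int k)"
  shows False
proof -
  define e :: "'a \<Rightarrow> 'a \<Rightarrow> int" where
    "e = (\<lambda>x y. if [g x y = 0] (mod int k) then 0 else if [g x y = h] (mod int k) then 1 else -1)"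
  have ge: "[g x y = h * e x y] (mod int k)" if "x \<in> U" "y \<in> U" "x \<noteq> y" for x y
    using pm[OF that] by (auto simp: e_def)
  have UV: "U \<subseteq> V" by (auto simp: U_def)
  have finU: "finite U" using fin UV finite_subset by blast
  \<comment> \<open>An interval of \<open>j + 1\<close> path weights yields \<open>j + 1\<close>
    consecutive translates of \<open>A\<close>, hence \<open>j\<close> new residues or all of them;
    \<open>extension_bound\<close> limits both.\<close>
  have interval: "j < card X \<and> dens k A + j < k"
    if X: "X \<subseteq> U" "w \<in> X" and i: "{i..i + int j} \<subseteq> weights_to e X w" for X w i j
  proof -
    let ?C = "\<Union>j\<le>j. translate (int j * h) A"
    have perC: "periodic k ?C"
      using periodic_translate[OF per] unfolding periodic_def by blast
    have "translate (i * h) ?C \<subseteq> (\<Union>\<tau>\<in>weights_to g X w. translate \<tau> A)"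
    proof
      fix x assume "x \<in> translate (i * h) ?C"
      then obtain m where m: "m \<le> j" "x - i * h - int m * h \<in> A" by (auto simp: translate_def)
      then have "i + int m \<in> weights_to e X w" using i by auto
      then obtain ys where ys: "path_in X ys" "last ys = w" "path_weight e ys = i + int m"
        by (auto simp: weights_to_def)
      have "[path_weight g ys = path_weight (\<lambda>x y. h * e x y) ys] (mod int k)"
        by (rule path_weight_mod_cong) (use ge ys X in \<open>auto simp: path_in_def\<close>)
      then have "[path_weight g ys = (i + int m) * h] (mod int k)"
        by (simp add: path_weight_scale ys(3) mult.commute)
      then have "[x - path_weight g ys = x - (i + int m) * h] (mod int k)"
        by (intro cong_diff) auto
      moreover have "x - (i + int m) * h \<in> A" using m(2) by (simp add: algebra_simps)
      ultimately have "x - path_weight g ys \<in> A" using periodicD[OF per] by blast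
      then show "x \<in> (\<Union>\<tau>\<in>weights_to g X w. translate \<tau> A)"
        using ys by (auto simp: translate_def weights_to_def)
    qed
    note b = extension_bound[OF X this]
    have "min k (dens k A + j) \<le> dens k ?C"
      by (rule dens_interval[OF l k per ord small(1)])
    also have "\<dots> = dens k (translate (i * h) ?C)" by (rule dens_translate[OF k perC, symmetric])
    finally show ?thesis using b by linarith
  qed
  have zero: "zero_cycle k f V" if "path_in U xs" "2 \<le> length xs"
    "path_weight e xs + e (last xs) (hd xs) = 0" for xs
    by (rule zero_cycle_mono[OF zero_cycle_potential[of U "f t" f h e k xs] UV])
      (use ge that in \<open>auto simp: g_def\<close>)
  have two_paths: "{0, e v x, e w x, e v w + e w x, e w v + e v x} \<subseteq> weights_to e {v, w, x} x"
    if "distinct [v, w, x]" for v w x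
  proof -
    have "path_weight e ys \<in> weights_to e {v, w, x} x"
      if "ys \<in> {[x], [v, x], [w, x], [v, w, x], [w, v, x]}" for ys
      using that \<open>distinct [v, w, x]\<close> unfolding weights_to_def path_in_def by auto
    from this[of "[x]"] this[of "[v, x]"] this[of "[w, x]"] this[of "[v, w, x]"] this[of "[w, v, x]"]
    show ?thesis by simp
  qed
  \<comment> \<open>Four consecutive weights would gain three residues with only three new
    vertices.\<close>
  have spread: "\<not> {i..i + 3} \<subseteq> {0, e v x, e w x, e v w + e w x, e w v + e v x}"
    if "v \<in> U" "w \<in> U" "x \<in> U" "distinct [v, w, x]" for v w x i
  proof
    assume "{i..i + 3} \<subseteq> {0, e v x, e w x, e v w + e w x, e w v + e v x}"
    then have "{i..i + int 3} \<subseteq> weights_to e {v, w, x} x" using two_paths[OF that(4)] by auto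
    from interval[OF _ _ this] that show False by auto
  qed
  have sets: "{-1..-1 + 3} = {-1, 0, 1, 2 :: int}" "{-2..-2 + 3} = {-2, -1, 0, 1 :: int}" by auto
  interpret unit_weights U e
  proof
    show "e x y \<in> {-1, 0, 1}" for x y by (simp add: e_def)
    show "e x y + e y x \<noteq> 0" if "x \<in> U" "y \<in> U" "x \<noteq> y" for x y
      using zero[of "[x, y]"] that no_cycle by (auto simp: path_in_def)
    show "e x y + e y z + e z x \<noteq> 0" if "x \<in> U" "y \<in> U" "z \<in> U" "distinct [x, y, z]" for x y z
      using zero[of "[x, y, z]"] that no_cycle by (auto simp: path_in_def)
    show "e x y + e y z + e z w + e w x \<noteq> 0"
      if "x \<in> U" "y \<in> U" "z \<in> U" "w \<in> U" "distinct [x, y, z, w]" for x y z w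
      using zero[of "[x, y, z, w]"] that no_cycle by (auto simp: path_in_def add.assoc)
    show "\<not> {-1, 1, 2} \<subseteq> {e v x, e w x, e v w + e w x, e w v + e v x}"
      if "v \<in> U" "w \<in> U" "x \<in> U" "distinct [v, w, x]" for v w x
      using spread[OF that, of "-1"] unfolding sets by blast
    show "\<not> {-2, -1, 1} \<subseteq> {e v x, e w x, e v w + e w x, e w v + e v x}"
      if "v \<in> U" "w \<in> U" "x \<in> U" "distinct [v, w, x]" for v w x
      using spread[OF that, of "-2"] unfolding sets by blast
  qed
  have "U \<noteq> {}" using small(2) by auto
  then obtain w i where w: "w \<in> U" "{i..i + int (card U) - 1} \<subseteq> weights_to e U w"
    by (rule interval_weights[OF finU])
  have "i + int (card U - 1) = i + int (card U) - 1" using small(2) by linarith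
  then have "{i..i + int (card U - 1)} \<subseteq> weights_to e U w" using w(2) by metis
  from interval[OF subset_refl w(1) this] have "dens k A + (card U - 1) < k" ..
  then show False using small(2) dens_Compl[of k A] by linarith
qed

end

section \<open>The induction on \<open>k\<close>\<close>

lemma big_omega_mult: "a > 0 \<Longrightarrow> b > 0 \<Longrightarrow> big_omega (a * b) = big_omega a + big_omega b"
  by (simp add: big_omega_def prime_factorization_mult)

lemma big_omega_pos: "a \<ge> 2 \<Longrightarrow> big_omega a \<ge> 1"
proof -
  assume "a \<ge> 2"
  then have "prime_factorization a \<noteq> {#}" by (auto simp: prime_factorization_empty_iff)
  then have "size (prime_factorization a) \<noteq> 0" by simp
  then show ?thesis unfolding big_omega_def by linarith
qed

text \<open>A suitable triple is admissible, so a largest admissible \<open>S\<close> has at least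
  three vertices and hence at least two residues. This bound later rules out the divisor
  \<open>d = 1\<close>.\<close>

lemma extremal_exists:
  assumes k: "k \<ge> 2" and fin: "finite V" and V: "card V \<ge> 3" and nc: "\<not> zero_cycle k f V"
  obtains S s t where "extremal k f V S s t" "2 \<le> dens k (residues_between k f S s t)"
proof -
  let ?P = "\<lambda>(S, s, t). S \<subseteq> V \<and> s \<in> S \<and> card S \<le> dens k (residues_between k f S s t) + 1"
  have k0: "k > 0" using k by simp
  obtain T where "T \<subseteq> V" "card T = 3" using obtain_subset_with_card_n[OF V] by blast
  then obtain s v w where svw: "T = {s, v, w}" "s \<noteq> v" "s \<noteq> w" "v \<noteq> w"
    by (auto simp: card_3_iff)
  have V3: "s \<in> V" "v \<in> V" "w \<in> V" using \<open>T \<subseteq> V\<close> svw by auto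
  \<comment> \<open>If for both orders of \<open>v\<close> and \<open>w\<close> the direct arc and
    the detour agreed, adding the two congruences would make the 2-cycle on \<open>v\<close>,
    \<open>w\<close> zero-sum.\<close>
  have base: "\<exists>v w. T = {s, v, w} \<and> distinct [s, v, w] \<and> \<not> [f s w = f s v + f v w] (mod int k)"
  proof (rule ccontr)
    assume none: "\<not> ?thesis"
    have svw': "T = {s, w, v}" using svw(1) by blast
    from none have "[f s w = f s v + f v w] (mod int k)" "[f s v = f s w + f w v] (mod int k)"
      using svw svw' by auto
    then have "[f s w + f s v = f s v + f v w + (f s w + f w v)] (mod int k)" by (rule cong_add)
    then have "int k dvd - (f v w + f w v)" by (simp add: cong_iff_dvd_diff algebra_simps)
    then have "int k dvd f v w + f w v" unfolding dvd_minus_iff .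
    then have "zero_cycle k f V"
      unfolding zero_cycle_def path_in_def by (intro exI[of _ "[v, w]"]) (use V3 svw in auto)
    with nc show False by simp
  qed
  then obtain v w where vw: "T = {s, v, w}" "distinct [s, v, w]"
    "\<not> [f s w = f s v + f v w] (mod int k)" by blast
  have mem: "path_weight f xs \<in> residues_between k f T s w"
    if "path_in T xs" "hd xs = s" "last xs = w" for xs
    unfolding residues_between_def using that by (intro CollectI exI[of _ xs]) simp
  have "path_in T [s, w]" "path_in T [s, v, w]" unfolding path_in_def vw(1) using vw(2) by simp_all
  then have "{f s w, f s v + f v w} \<subseteq> residues_between k f T s w"
    using mem[of "[s, w]"] mem[of "[s, v, w]"] by simp
  then have "card {f s w, f s v + f v w} \<le> dens k (residues_between k f T s w)"
    by (intro card_le_dens[OF k0 periodic_residues_between _ _ inj_mod_pair[OF vw(3)]]) simp_all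
  moreover have "f s w \<noteq> f s v + f v w" using vw(3) by (metis cong_refl)
  ultimately have "2 \<le> dens k (residues_between k f T s w)" by simp
  then have P0: "?P (T, s, w)" using \<open>T \<subseteq> V\<close> \<open>card T = 3\<close> svw by simp
  have "\<forall>y. ?P y \<longrightarrow> (card \<circ> fst) y < Suc (card V)"
    using fin by (auto simp: less_Suc_eq_le intro: card_mono)
  from ex_has_greatest_nat[where P = ?P and f = "card \<circ> fst", OF P0 this]
  obtain z where z: "?P z" "\<And>y. ?P y \<Longrightarrow> (card \<circ> fst) y \<le> (card \<circ> fst) z" by blast
  obtain S s' t' where zeq: "z = (S, s', t')" by (cases z)
  have P: "?P (S, s', t')" and mx: "\<And>y. ?P y \<Longrightarrow> (card \<circ> fst) y \<le> card S"
    using z unfolding zeq by simp_all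
  have "extremal k f V S s' t'"
  proof
    show "card S' \<le> card S" if "S' \<subseteq> V" "s'' \<in> S'"
      "card S' \<le> dens k (residues_between k f S' s'' t'') + 1" for S' s'' t''
      using mx[of "(S', s'', t'')"] that by simp
  qed (use P k0 fin nc in auto)
  moreover have "3 \<le> card S" using mx[OF P0] \<open>card T = 3\<close> by simp
  then have "2 \<le> dens k (residues_between k f S s' t')" using P by simp
  ultimately show thesis by (rule that)
qed

text \<open>\<open>d\<close> is the gcd of \<open>k\<close> and \<open>h\<close>, and
  \<open>l\<close> is the order of \<open>h\<close> modulo \<open>k\<close>.\<close>

lemma dvd_order:
  fixes h :: int
  assumes k: "k > 0"
  obtains d l :: nat where "d > 0" "l > 0" "k = d * l" "int d dvd h"
    "\<And>i :: int. int k dvd i * h \<Longrightarrow> int l dvd i"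
proof -
  define d where "d = nat (gcd (int k) h)"
  have d: "int d = gcd (int k) h" "d > 0" using k by (auto simp: d_def)
  have "int d dvd int k" using d(1) by simp
  then obtain l where l: "k = d * l" unfolding int_dvd_int_iff by (auto simp: dvd_def)
  have hd: "int d dvd h" using d(1) by simp
  then obtain h' where h': "h = int d * h'" by (auto simp: dvd_def)
  have "gcd (int d * int l) (int d * h') = int d" using d(1) l h' by simp
  then have "int d * gcd (int l) h' = int d * 1" by (simp add: gcd_mult_distrib_int[symmetric])
  then have cop: "coprime (int l) h'" using d(2) by (simp add: coprime_iff_gcd_eq_1)
  have "int l dvd i" if "int k dvd i * h" for i
  proof -
    have "int d * int l dvd int d * (i * h')" using that l h' by (simp add: ac_simps)
    then have "int l dvd i * h'" using d(2) by simp
    then show ?thesis using cop by (simp add: coprime_dvd_mult_left_iff)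
  qed
  then show thesis using that[of d l] d(2) l hd k by auto
qed

text \<open>The bound \<open>2 <= card V\<close> matters for \<open>k = 1\<close>, a case the
  induction reaches and where the other bound asks for only one vertex.\<close>

lemma zero_cycle_exists:
  assumes "k > 0" "finite V" "2 \<le> card V" "k + 2 * big_omega k \<le> card V"
  shows "zero_cycle k f V"
  using assms
proof (induction k arbitrary: f V rule: less_induct)
  case (less k)
  show ?case
  proof (cases "k = 1")
    case True
    obtain T where "T \<subseteq> V" "card T = 2" using obtain_subset_with_card_n[OF less.prems(3)] by blast
    then obtain x y where "x \<in> V" "y \<in> V" "x \<noteq> y" by (auto simp: card_2_iff)
    then show ?thesis using True
      unfolding zero_cycle_def path_in_def by (intro exI[of _ "[x, y]"]) auto
  next
    case False
    then have k2: "k \<ge> 2" using less.prems(1) by simp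
    have om: "big_omega k \<ge> 1" by (rule big_omega_pos[OF k2])
    have V3: "card V \<ge> 3" using less.prems(4) k2 om by linarith
    show ?thesis
    proof (rule ccontr)
      assume nc: "\<not> zero_cycle k f V"
      obtain S s t where ext: "extremal k f V S s t" and two: "2 \<le> dens k (residues_between k f S s t)"
        by (rule extremal_exists[OF k2 less.prems(2) V3 nc])
      interpret extremal k f V S s t by (rule ext)
      have two: "2 \<le> dens k A" using two by (simp add: A_def)
      have UV: "U \<subseteq> V" "finite U" using fin by (auto simp: U_def)
      have "card U = card V - card S"
        unfolding U_def using S(1) fin by (intro card_Diff_subset) (auto intro: finite_subset)
      moreover have "card S \<le> dens k A + 1" using S_dens by (simp add: A_def)
      ultimately have cU: "dens k (- A) + 2 * big_omega k \<le> card U + 1"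
        using less.prems(4) dens_Compl[of k A] by linarith
      have "card U > 0" using cU om by linarith
      then obtain u where u: "u \<in> U" by (auto simp: card_gt_0_iff)
      have cpos: "1 \<le> dens k (- A)" using dens_less[OF u] dens_Compl[of k A] by linarith
      have cU2: "2 \<le> card U" using cU cpos om by linarith
      \<comment> \<open>The weights are divided by \<open>d\<close> and the induction hypothesis is
        applied to \<open>l\<close> and \<open>U\<close>. Since \<open>big_omega d >= 1\<close>,
        passing from \<open>k\<close> to \<open>l\<close> frees at least 2, which pays for the 1
        lost in \<open>cU\<close> and the 1 allowed in the bound on \<open>l\<close>.\<close>
      have descend: False if d: "d \<ge> 2" "k = d * l" "l \<le> dens k (- A) + 1"
        and dv: "\<And>x y. x \<in> U \<Longrightarrow> y \<in> U \<Longrightarrow> x \<noteq> y \<Longrightarrow> int d dvd g x y" for d l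
      proof -
        have l: "l > 0" "l < k" using d k by auto
        have "big_omega k = big_omega d + big_omega l" using d l by (simp add: big_omega_mult)
        then have "l + 2 * big_omega l \<le> card U" using cU d(3) big_omega_pos[OF d(1)] by linarith
        then have "zero_cycle l (\<lambda>x y. g x y div int d) U"
          using less.IH[OF l(2) l(1) UV(2) cU2] by blast
        then obtain xs where xs: "path_in U xs" "2 \<le> length xs"
          "int l dvd path_weight (\<lambda>x y. g x y div int d) xs + g (last xs) (hd xs) div int d"
          unfolding zero_cycle_def by blast
        have "zero_cycle k f U"
        proof (rule zero_cycle_potential[OF _ xs(1,2)])
          show "[f t x + f x y - f t y = int d * (g x y div int d)] (mod int k)"
            if "x \<in> U" "y \<in> U" "x \<noteq> y" for x y
            using dv[OF that] by (simp add: g_def)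
          show "int k dvd int d * (path_weight (\<lambda>x y. g x y div int d) xs + g (last xs) (hd xs) div int d)"
            using xs(3) d(2) by (simp add: mult_dvd_mono)
        qed
        then show False using zero_cycle_mono UV(1) nc by blast
      qed
      have small: "2 \<le> dens k (- A)"
      proof (rule ccontr)
        assume "\<not> ?thesis"
        then have "int k dvd g x y" if "x \<in> U" "y \<in> U" "x \<noteq> y" for x y
          using pair_dvd[OF that] by simp
        then show False using descend[of k 1] k2 by simp
      qed
      let ?D = "{h. tight k A h}"
      have perD: "periodic k ?D"
        unfolding periodic_def using tight_cong[OF per] by blast
      have um: "- h \<in> ?D" if "h \<in> ?D" for h using tight_uminus[OF k per] that by simp
      have "(\<forall>g\<in>?D. \<forall>h\<in>?D. g + h \<in> ?D) \<or>
        (\<exists>h\<in>?D. \<not> [h = 0] (mod int k) \<and>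
          (\<forall>g\<in>?D. [g = 0] (mod int k) \<or> [g = h] (mod int k) \<or> [g = - h] (mod int k)))"
        by (rule closed_or_pm[OF _ perD um]) (use tight_add[OF per] tight_0 in auto)
      then show False
      proof
        assume closed: "\<forall>g\<in>?D. \<forall>h\<in>?D. g + h \<in> ?D"
        have kD: "int k \<in> ?D"
          using periodicD[OF perD, of "int k" 0] tight_0 by (simp add: cong_iff_dvd_diff)
        obtain d where d: "d > 0" "?D = {x. int d dvd x}"
          by (rule int_subgroup_principal[OF k kD closed um])
        have "int d dvd int k" using kD d(2) by blast
        then obtain l where l: "k = d * l" unfolding int_dvd_int_iff by (auto simp: dvd_def)
        have lpos: "l > 0" using l k by (cases l) auto
        have le: "l - 1 \<le> dens k (- A)"
          using tight_subgroup_complement[of l d A] lpos d per small l by auto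
        \<comment> \<open>For \<open>d = 1\<close> at least \<open>k - 1\<close> residues would be
          missing, but \<open>A\<close> has two.\<close>
        have "d \<noteq> 1" using le l two dens_Compl[of k A] by auto
        then have d2: "d \<ge> 2" using d(1) by simp
        have dv: "int d dvd g x y" if "x \<in> U" "y \<in> U" "x \<noteq> y" for x y
          using pair_tight[OF that] d(2) by blast
        show False by (rule descend[OF d2 l _ dv]) (use le in linarith)
      next
        assume "\<exists>h\<in>?D. \<not> [h = 0] (mod int k) \<and>
          (\<forall>g\<in>?D. [g = 0] (mod int k) \<or> [g = h] (mod int k) \<or> [g = - h] (mod int k))"
        then obtain h where "\<And>g. g \<in> ?D \<Longrightarrow>
            [g = 0] (mod int k) \<or> [g = h] (mod int k) \<or> [g = - h] (mod int k)" by blast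
        then have h: "[g x y = 0] (mod int k) \<or> [g x y = h] (mod int k) \<or> [g x y = - h] (mod int k)"
          if "x \<in> U" "y \<in> U" "x \<noteq> y" for x y
          using pair_tight[OF that] by blast
        obtain d l where dl: "d > 0" "l > 0" "k = d * l" "int d dvd h"
          "\<And>i :: int. int k dvd i * h \<Longrightarrow> int l dvd i"
          using dvd_order[OF k, of h] by blast
        show False
        \<comment> \<open>Either the subgroup generated by \<open>h\<close> has more elements than
          there are missing residues, and progressions with difference \<open>h\<close> fill them,
          or it is small enough for \<open>descend\<close>.\<close>
        proof (cases "dens k (- A) < l")
          case True
          then show False
            using no_unit_weights[OF dl(2) dl(5) True _ h] cU om by simp
        next
          case False
          have "d \<noteq> 1" using False dl(3) two dens_Compl[of k A] by auto
          moreover have "int d dvd g x y" if "x \<in> U" "y \<in> U" "x \<noteq> y" for x y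
          proof -
            have "int d dvd int k" using dl(3) by simp
            then show ?thesis
              using h[OF that] dl(4) by (meson cong_dvd_iff cong_dvd_modulus dvd_0_right dvd_minus_iff)
          qed
          ultimately show False using descend[of d l] dl False by simp
        qed
      qed
    qed
  qed
qed

section \<open>From vertex lists to cycles of arcs\<close>

fun arcs_along :: "('a \<Rightarrow> 'a \<Rightarrow> 'b) \<Rightarrow> 'a list \<Rightarrow> 'b list" where
  "arcs_along a (x # y # zs) = a x y # arcs_along a (y # zs)"
| "arcs_along a [x] = []"
| "arcs_along a [] = []"

lemma sum_list_arcs_along:
  "sum_list (map c (arcs_along a xs)) = path_weight (\<lambda>x y. c (a x y)) xs"
  by (induction a xs rule: arcs_along.induct) auto

lemma path_weight_add_head:
  "path_weight (\<lambda>x y. c x y + p y) xs = path_weight c xs + sum_list (map p (tl xs))"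
  by (induction c xs rule: path_weight.induct) auto

lemma arcs_along_walk:
  assumes "successively (\<lambda>x y. a x y \<in> arcs G \<and> tail G (a x y) = x \<and> head G (a x y) = y) xs" "xs \<noteq> []"
  shows "set (arcs_along a xs) \<subseteq> arcs G" "pre_digraph.cas G (hd xs) (arcs_along a xs) (last xs)"
    "pre_digraph.awalk_verts G (hd xs) (arcs_along a xs) = xs"
    "map (tail G) (arcs_along a xs) = butlast xs" "map (head G) (arcs_along a xs) = tl xs"
  using assms
  by (induction a xs rule: arcs_along.induct)
    (auto simp: pre_digraph.cas.simps pre_digraph.awalk_verts.simps)

theorem theorem1:
  fixes k n :: nat
    and G :: "('a, 'b) pre_digraph"
    and wv :: "'a \<Rightarrow> int"
    and we :: "'b \<Rightarrow> int"
  assumes "k \<ge> 2"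
    and "complete_digraph n G"
    and "n \<ge> k + 2 * big_omega k"
  shows "\<exists>p. pre_digraph.cycle G p \<and> [subgraph_weight wv we (walk_subgraph G p) = 0] (mod (int k))"
proof -
  interpret graph G using assms(2) by (simp add: complete_digraph_def)
  have card: "card (verts G) = n"
    and ends: "arcs_ends G = {(u, v). (u, v) \<in> verts G \<times> verts G \<and> u \<noteq> v}"
    using assms(2) by (auto simp: complete_digraph_def)
  have "\<exists>e. e \<in> arcs G \<and> tail G e = x \<and> head G e = y" if "x \<in> verts G" "y \<in> verts G" "x \<noteq> y" for x y
  proof -
    have "(x, y) \<in> arcs_ends G" unfolding ends using that by simp
    then show ?thesis by (auto simp: arcs_ends_conv)
  qed
  then obtain a where a: "\<And>x y. x \<in> verts G \<Longrightarrow> y \<in> verts G \<Longrightarrow> x \<noteq> y \<Longrightarrow>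
      a x y \<in> arcs G \<and> tail G (a x y) = x \<and> head G (a x y) = y" by metis
  \<comment> \<open>The weight of a vertex is charged to the arc entering it; a cycle enters each of
    its vertices exactly once.\<close>
  define f where "f = (\<lambda>x y. we (a x y) + wv y)"
  have "zero_cycle k f (verts G)"
    by (rule zero_cycle_exists) (use assms(1,3) card in auto)
  then obtain xs where xs: "xs \<noteq> []" "distinct xs" "set xs \<subseteq> verts G" "2 \<le> length xs"
    and dvd: "int k dvd path_weight f xs + f (last xs) (hd xs)"
    unfolding zero_cycle_def path_in_def by blast
  \<comment> \<open>Repeating the first vertex closes the walk; the tails of its arcs form
    \<open>xs\<close>, and their heads \<open>tl ?ys\<close> form a rotation of
    \<open>xs\<close>.\<close>
  let ?ys = "xs @ [hd xs]"
  let ?p = "arcs_along a ?ys"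
  have sub: "successively (\<lambda>x y. a x y \<in> arcs G \<and> tail G (a x y) = x \<and> head G (a x y) = y) zs"
    if "distinct zs" "set zs \<subseteq> verts G" for zs
    using that by (induction zs rule: induct_list012) (auto simp: a)
  have "a (last xs) (hd xs) \<in> arcs G \<and> tail G (a (last xs) (hd xs)) = last xs \<and>
      head G (a (last xs) (hd xs)) = hd xs"
    using xs hd_neq_last[OF xs(2,4)] by (intro a) auto
  then have "successively (\<lambda>x y. a x y \<in> arcs G \<and> tail G (a x y) = x \<and> head G (a x y) = y) ?ys"
    using sub[OF xs(2,3)] by (simp add: successively_append_iff)
  note walk = arcs_along_walk[OF this, simplified]
  have p_ne: "?p \<noteq> []" using walk(4) xs(1) by auto
  have hd: "hd ?ys = hd xs" "hd xs \<in> verts G" using xs by auto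
  have rot: "set (tl xs @ [hd xs]) = set xs" "distinct (tl xs @ [hd xs])"
    using xs(1,2) by (cases xs; auto)+
  have "awalk (hd xs) ?p (hd xs)"
    using walk(1,2) hd by (simp add: awalk_def)
  moreover have "distinct (tl (awalk_verts (hd xs) ?p))"
    using walk(3) hd rot(2) xs(1) by simp
  ultimately have cyc: "cycle ?p" using p_ne unfolding cycle_def by blast
  \<comment> \<open>The arcs are distinct because their tails are; hence the sum over the set of
    arcs equals the sum along the list.\<close>
  have dist_p: "distinct ?p" using walk(4) xs(2) by (metis distinct_map)
  have "tail G ` set ?p = set (map (tail G) ?p)" "head G ` set ?p = set (map (head G) ?p)"
    by simp_all
  then have verts: "tail G ` set ?p \<union> head G ` set ?p = set xs"
    using walk(4,5) rot(1) xs(1) by simp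
  have "subgraph_weight wv we (walk_subgraph G ?p) = (\<Sum>v\<in>set xs. wv v) + (\<Sum>e\<in>set ?p. we e)"
    by (simp add: subgraph_weight_def walk_subgraph_def verts)
  also have "(\<Sum>v\<in>set xs. wv v) = sum_list (map wv (tl ?ys))"
    using sum_list_distinct_conv_sum_set[OF rot(2), of wv] rot(1) xs(1) by simp
  also have "(\<Sum>e\<in>set ?p. we e) = path_weight (\<lambda>x y. we (a x y)) ?ys"
    by (simp only: sum_list_distinct_conv_sum_set[OF dist_p, symmetric] sum_list_arcs_along)
  also have "sum_list (map wv (tl ?ys)) + path_weight (\<lambda>x y. we (a x y)) ?ys = path_weight f ?ys"
    unfolding f_def path_weight_add_head by simp
  also have "\<dots> = path_weight f xs + f (last xs) (hd xs)"
    using xs(1) by (simp add: path_weight_append)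
  finally show ?thesis using cyc dvd by (auto simp: cong_0_iff intro!: exI[of _ ?p])
qed

end
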